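(* Let $(M,J,g)$ be an $(\alpha,\varepsilon)$-metric manifold with fundamental tensor $\phi(\cdot,\cdot)=g(J\cdot,\cdot)$, let $\mathcal G_g$ be the generalized metric on $\mathbb TM=TM\oplus T^*M$ induced by $g$, and let $$\mathcal J_\phi=\begin{pmatrix}0&-\sharp_\phi\\ \flat_\phi&0\end{pmatrix},\qquad \mathcal F_\phi=\begin{pmatrix}0&\sharp_\phi\\ \flat_\phi&0\end{pmatrix}.$$ Then $(\mathcal J_\phi,\mathcal G_g)$ is a generalized almost Hermitian or indefinite almost Hermitian structure (depending on whether $g$ is Riemannian or pseudo-Riemannian) when $\varepsilon=+1$, and a generalized almost Norden structure when $\varepsilon=-1$. On the other hand, $(\mathcal F_\phi,\mathcal G_g)$ is a generalized almost para-Norden or pseudo-Riemannian almost product structure (depending on whether $g$ is Riemannian or pseudo-Riemannian) when $\varepsilon=+1$, and a generalized almost para-Hermitian structure when $\varepsilon=-1$. When $\varepsilon=+1$, their fundamental tensors are $$\Phi_{\mathcal J_\phi}(X+\xi,Y+\eta)=-2\Omega_0(JX+\xi,JY+\eta),\qquad \Phi_{\mathcal F_\phi}(X+\xi,Y+\eta)=2\mathcal G_0(JX+\xi,JY+\eta),$$ while for $\varepsilon=-1$ they are $$\Phi_{\mathcal J_\phi}(X+\xi,Y+\eta)=2\mathcal G_0(JX+\xi,JY+\eta),\qquad \Phi_{\mathcal F_\phi}(X+\xi,Y+\eta)=-2\Omega_0(JX+\xi,JY+\eta),$$ for all $X,Y\in\mathfrak X(M)$, $\xi,\eta\in\Lam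bda^1(M)$.
   Context: An $(\alpha,\varepsilon)$-metric manifold $(M,J,g)$, $\alpha,\varepsilon\in\{+1,-1\}$, is a smooth manifold with a Riemannian or pseudo-Riemannian (i.e. nondegenerate, not positive definite) metric $g$ and an $\mathfrak F(M)$-linear $J\colon\mathfrak X(M)\to\mathfrak X(M)$ with $J^2=\alpha Id$ and $g(JX,JY)=\varepsilon g(X,Y)$ for all $X,Y$. Its fundamental tensor $\phi$ is a metric if $\alpha\varepsilon=+1$ and an almost symplectic form (nondegenerate 2-form) if $\alpha\varepsilon=-1$. $\mathfrak F(M)$, $\mathfrak X(M)$, $\Lambda^1(M)$ denote smooth functions, vector fields, 1-forms; sections of $\mathbb TM$ are written $X+\xi$. For a nondegenerate bilinear form $b$ on $M$: $(\flat_bX)(Y)=b(X,Y)$, $\sharp_b=\flat_b^{-1}$. Matrix notation: $\begin{pmatrix}H&\sigma\\ \tau&K\end{pmatrix}(X+\xi)=(HX+\sigma\xi)+(\tau X+K\xi)$. $\mathcal G_g(X+\xi,Y+\eta)=g(X,Y)+g(\sharp_g\xi,\sharp_g\eta)$; $\mathcal G_0(X+\xi,Y+\eta)=\frac12(\xi(Y)+\eta(X))$; $\Omega_0(X+\xi,Y+\eta)=\frac12(\xi(Y)-\eta(X))$. For an $\mathfrak F(M)$-linear endomorphism $\mathcal K$ of $\Gamma(\mathbb TM)$ with $\mathcal K^2=aId$ and a metric $\mathcal G$ on $\mathbb TM$ with $\mathcal G(\mathcal Ku,\mathcal Kv)=e\,\mathcal G(u,v)$ for all sections $u,v$ ($a,e\in\{\pm1\}$),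 the pair $(\mathcal K,\mathcal G)$ is: for $a=-1,e=+1$, generalized almost Hermitian (resp. indefinite almost Hermitian) if $\mathcal G$ is Riemannian (resp. pseudo-Riemannian); for $a=e=-1$, generalized almost Norden; for $a=+1,e=-1$, generalized almost para-Hermitian; for $a=e=+1$, generalized pseudo-Riemannian almost product if $\mathcal G$ is pseudo-Riemannian, and generalized almost para-Norden if $\mathcal G$ is Riemannian and the $\pm1$-eigenbundles of $\mathcal K$ have equal rank. The fundamental tensor of $(\mathcal K,\mathcal G)$ is $\Phi_{\mathcal K}(u,v)=\mathcal G(\mathcal Ku,v)$ (here with $\mathcal G=\mathcal G_g$). *)

theory Defs
  imports "HOL-Analysis.Analysis"
begin

section \<open>Smooth manifolds\<close>

text \<open>
  Meant for open \<open>S\<close>: all directional derivatives of order up to \<open>k\<close> exist and are continuous.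
\<close>

primrec Ck_on ::
  "nat \<Rightarrow> 'e::euclidean_space set \<Rightarrow> ('e \<Rightarrow> 'f::real_normed_vector) \<Rightarrow> bool" where
  "Ck_on 0 S f \<longleftrightarrow> continuous_on S f"
| "Ck_on (Suc k) S f \<longleftrightarrow>
     (\<forall>x\<in>S. f differentiable (at x)) \<and>
     (\<forall>v. Ck_on k S (\<lambda>x. frechet_derivative f (at x) v))"

definition smooth_on :: "'e::euclidean_space set \<Rightarrow> ('e \<Rightarrow> 'f::real_normed_vector) \<Rightarrow> bool" where
  "smooth_on S f \<longleftrightarrow> (\<forall>k. Ck_on k S f)"

text \<open>
  The manifold is a whole type \<open>'a\<close>, modelled on \<open>'e\<close>. A chart is a pair of its domain and its
  coordinate map; the values of the map outside the domain are irrelevant.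
\<close>

type_synonym ('a, 'e) chart = "'a set \<times> ('a \<Rightarrow> 'e)"

definition chart_image :: "('a, 'e) chart \<Rightarrow> 'e set" where
  "chart_image c = snd c ` fst c"

definition chart_inv :: "('a, 'e) chart \<Rightarrow> 'e \<Rightarrow> 'a" where
  "chart_inv c = inv_into (fst c) (snd c)"

definition smooth_atlas ::
  "('a::{t2_space, second_countable_topology}, 'e::euclidean_space) chart set \<Rightarrow> bool" where
  "smooth_atlas A \<longleftrightarrow>
     (\<Union>c\<in>A. fst c) = UNIV \<and>
     (\<forall>c\<in>A. open (fst c) \<and> open (chart_image c) \<and>
        homeomorphism (fst c) (chart_image c) (snd c) (chart_inv c)) \<and>
     (\<forall>c\<in>A. \<forall>d\<in>A. smooth_on (snd c ` (fst c \<inter> fst d)) (snd d \<circ> chart_inv c))"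

definition smooth_functions :: "('a, 'e::euclidean_space) chart set \<Rightarrow> ('a \<Rightarrow> real) set" where
  "smooth_functions A = {f. \<forall>c\<in>A. smooth_on (chart_image c) (f \<circ> chart_inv c)}"

text \<open>
  The tangent space at \<open>p\<close> is \<open>'e\<close>: a tangent vector is represented by its components in one
  chosen chart around \<open>p\<close>. The two maps below translate between this representation and the
  components in an arbitrary chart \<open>c\<close> around \<open>p\<close>, by the derivative of the coordinate change;
  for \<open>p\<close> in the domain of \<open>c\<close> they are inverse to each other. The choice of \<open>chart_at\<close> may jump
  from point to point; smoothness is therefore always expressed in the components with respect
  to the charts of the atlas.
\<close>

definition chart_at :: "('a, 'e) chart set \<Rightarrow> 'a \<Rightarrow> ('a, 'e) chart" where
  "chart_at A p = (SOME c. c \<in> A \<and> p \<in> fst c)"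

definition tangent_to_chart ::
  "('a, 'e::euclidean_space) chart set \<Rightarrow> ('a, 'e) chart \<Rightarrow> 'a \<Rightarrow> 'e \<Rightarrow> 'e" where
  "tangent_to_chart A c p =
     frechet_derivative (snd c \<circ> chart_inv (chart_at A p)) (at (snd (chart_at A p) p))"

definition tangent_of_chart ::
  "('a, 'e::euclidean_space) chart set \<Rightarrow> ('a, 'e) chart \<Rightarrow> 'a \<Rightarrow> 'e \<Rightarrow> 'e" where
  "tangent_of_chart A c p =
     frechet_derivative (snd (chart_at A p) \<circ> chart_inv c) (at (snd c p))"

definition vector_fields :: "('a, 'e::euclidean_space) chart set \<Rightarrow> ('a \<Rightarrow> 'e) set" where
  "vector_fields A =
     {X. \<forall>c\<in>A. smooth_on (chart_image c) ((\<lambda>p. tangent_to_chart A c p (X p)) \<circ> chart_inv c)}"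

definition one_forms ::
  "('a, 'e::euclidean_space) chart set \<Rightarrow> ('a \<Rightarrow> 'e \<Rightarrow>\<^sub>L real) set" where
  "one_forms A =
     {\<xi>. \<forall>c\<in>A. \<forall>v. smooth_on (chart_image c)
        ((\<lambda>p. blinfun_apply (\<xi> p) (tangent_of_chart A c p v)) \<circ> chart_inv c)}"

definition pairing :: "('a \<Rightarrow> 'e \<Rightarrow>\<^sub>L real) \<Rightarrow> ('a \<Rightarrow> 'e::euclidean_space) \<Rightarrow> 'a \<Rightarrow> real" where
  "pairing \<xi> X = (\<lambda>p. blinfun_apply (\<xi> p) (X p))"

text \<open>The section \<open>X + \<xi>\<close> of \<open>TM \<oplus> T\<^sup>*M\<close>.\<close>

definition gen_section ::
  "('a \<Rightarrow> 'e) \<Rightarrow> ('a \<Rightarrow> 'e \<Rightarrow>\<^sub>L real) \<Rightarrow> 'a \<Rightarrow> 'e::euclidean_space \<times> ('e \<Rightarrow>\<^sub>L real)" where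
  "gen_section X \<xi> = (\<lambda>p. (X p, \<xi> p))"

definition gen_sections ::
  "('a, 'e::euclidean_space) chart set \<Rightarrow> ('a \<Rightarrow> 'e \<times> ('e \<Rightarrow>\<^sub>L real)) set" where
  "gen_sections A = {u. fst \<circ> u \<in> vector_fields A \<and> snd \<circ> u \<in> one_forms A}"


section \<open>Tensors on the sections of a bundle\<close>

text \<open>
  Tensor fields are multilinear maps over the ring of smooth functions. The parameter \<open>\<Gamma>\<close> is the
  module of smooth sections, either of \<open>TM\<close> or of \<open>TM \<oplus> T\<^sup>*M\<close>.
\<close>

definition linear_endo ::
  "('a, 'e::euclidean_space) chart set \<Rightarrow> ('a \<Rightarrow> 'v::real_vector) set \<Rightarrow>
   (('a \<Rightarrow> 'v) \<Rightarrow> 'a \<Rightarrow> 'v) \<Rightarrow> bool" where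
  "linear_endo A \<Gamma> K \<longleftrightarrow>
     (\<forall>u\<in>\<Gamma>. K u \<in> \<Gamma>) \<and>
     (\<forall>u\<in>\<Gamma>. \<forall>v\<in>\<Gamma>. K (\<lambda>p. u p + v p) = (\<lambda>p. K u p + K v p)) \<and>
     (\<forall>f\<in>smooth_functions A. \<forall>u\<in>\<Gamma>. K (\<lambda>p. f p *\<^sub>R u p) = (\<lambda>p. f p *\<^sub>R K u p))"

definition bilinear_form ::
  "('a, 'e::euclidean_space) chart set \<Rightarrow> ('a \<Rightarrow> 'v::real_vector) set \<Rightarrow>
   (('a \<Rightarrow> 'v) \<Rightarrow> ('a \<Rightarrow> 'v) \<Rightarrow> 'a \<Rightarrow> real) \<Rightarrow> bool" where
  "bilinear_form A \<Gamma> b \<longleftrightarrow>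
     (\<forall>u\<in>\<Gamma>. \<forall>v\<in>\<Gamma>. b u v \<in> smooth_functions A) \<and>
     (\<forall>u\<in>\<Gamma>. \<forall>v\<in>\<Gamma>. \<forall>w\<in>\<Gamma>.
        b (\<lambda>p. u p + v p) w = (\<lambda>p. b u w p + b v w p) \<and>
        b w (\<lambda>p. u p + v p) = (\<lambda>p. b w u p + b w v p)) \<and>
     (\<forall>f\<in>smooth_functions A. \<forall>u\<in>\<Gamma>. \<forall>v\<in>\<Gamma>.
        b (\<lambda>p. f p *\<^sub>R u p) v = (\<lambda>p. f p * b u v p) \<and>
        b u (\<lambda>p. f p *\<^sub>R v p) = (\<lambda>p. f p * b u v p))"

text \<open>Nondegeneracy and positive definiteness are required on every fibre.\<close>

definition nondegenerate ::
  "('a \<Rightarrow> 'v::real_vector) set \<Rightarrow> (('a \<Rightarrow> 'v) \<Rightarrow> ('a \<Rightarrow> 'v) \<Rightarrow> 'a \<Rightarrow> real) \<Rightarrow> bool" where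
  "nondegenerate \<Gamma> b \<longleftrightarrow>
     (\<forall>p. \<forall>u\<in>\<Gamma>. (\<forall>v\<in>\<Gamma>. b u v p = 0) \<longrightarrow> u p = 0) \<and>
     (\<forall>p. \<forall>v\<in>\<Gamma>. (\<forall>u\<in>\<Gamma>. b u v p = 0) \<longrightarrow> v p = 0)"

definition positive_definite ::
  "('a \<Rightarrow> 'v::real_vector) set \<Rightarrow> (('a \<Rightarrow> 'v) \<Rightarrow> ('a \<Rightarrow> 'v) \<Rightarrow> 'a \<Rightarrow> real) \<Rightarrow> bool" where
  "positive_definite \<Gamma> b \<longleftrightarrow> (\<forall>p. \<forall>u\<in>\<Gamma>. u p \<noteq> 0 \<longrightarrow> b u u p > 0)"

definition metric ::
  "('a, 'e::euclidean_space) chart set \<Rightarrow> ('a \<Rightarrow> 'v::real_vector) set \<Rightarrow>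
   (('a \<Rightarrow> 'v) \<Rightarrow> ('a \<Rightarrow> 'v) \<Rightarrow> 'a \<Rightarrow> real) \<Rightarrow> bool" where
  "metric A \<Gamma> b \<longleftrightarrow>
     bilinear_form A \<Gamma> b \<and> (\<forall>u\<in>\<Gamma>. \<forall>v\<in>\<Gamma>. b u v = b v u) \<and> nondegenerate \<Gamma> b"

definition riemannian ::
  "('a, 'e::euclidean_space) chart set \<Rightarrow> ('a \<Rightarrow> 'v::real_vector) set \<Rightarrow>
   (('a \<Rightarrow> 'v) \<Rightarrow> ('a \<Rightarrow> 'v) \<Rightarrow> 'a \<Rightarrow> real) \<Rightarrow> bool" where
  "riemannian A \<Gamma> b \<longleftrightarrow> metric A \<Gamma> b \<and> positive_definite \<Gamma> b"

definition pseudo_riemannian ::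
  "('a, 'e::euclidean_space) chart set \<Rightarrow> ('a \<Rightarrow> 'v::real_vector) set \<Rightarrow>
   (('a \<Rightarrow> 'v) \<Rightarrow> ('a \<Rightarrow> 'v) \<Rightarrow> 'a \<Rightarrow> real) \<Rightarrow> bool" where
  "pseudo_riemannian A \<Gamma> b \<longleftrightarrow> metric A \<Gamma> b \<and> \<not> positive_definite \<Gamma> b"

definition metric_structure ::
  "('a, 'e::euclidean_space) chart set \<Rightarrow> ('a \<Rightarrow> 'v::real_vector) set \<Rightarrow>
   (('a \<Rightarrow> 'v) \<Rightarrow> 'a \<Rightarrow> 'v) \<Rightarrow> (('a \<Rightarrow> 'v) \<Rightarrow> ('a \<Rightarrow> 'v) \<Rightarrow> 'a \<Rightarrow> real) \<Rightarrow>
   real \<Rightarrow> real \<Rightarrow> bool" where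
  "metric_structure A \<Gamma> K b a e \<longleftrightarrow>
     linear_endo A \<Gamma> K \<and> (\<forall>u\<in>\<Gamma>. K (K u) = (\<lambda>p. a *\<^sub>R u p)) \<and>
     metric A \<Gamma> b \<and> (\<forall>u\<in>\<Gamma>. \<forall>v\<in>\<Gamma>. b (K u) (K v) = (\<lambda>p. e * b u v p))"

definition metric_manifold ::
  "('a::{t2_space, second_countable_topology}, 'e::euclidean_space) chart set \<Rightarrow>
   (('a \<Rightarrow> 'e) \<Rightarrow> 'a \<Rightarrow> 'e) \<Rightarrow> (('a \<Rightarrow> 'e) \<Rightarrow> ('a \<Rightarrow> 'e) \<Rightarrow> 'a \<Rightarrow> real) \<Rightarrow>
   real \<Rightarrow> real \<Rightarrow> bool" where
  "metric_manifold A J g \<alpha> \<epsilon> \<longleftrightarrow>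
     smooth_atlas A \<and> \<alpha> \<in> {1, -1} \<and> \<epsilon> \<in> {1, -1} \<and>
     metric_structure A (vector_fields A) J g \<alpha> \<epsilon>"

definition fundamental_tensor ::
  "(('a \<Rightarrow> 'v) \<Rightarrow> 'a \<Rightarrow> 'v) \<Rightarrow> (('a \<Rightarrow> 'v) \<Rightarrow> ('a \<Rightarrow> 'v) \<Rightarrow> 'a \<Rightarrow> real) \<Rightarrow>
   ('a \<Rightarrow> 'v) \<Rightarrow> ('a \<Rightarrow> 'v) \<Rightarrow> 'a \<Rightarrow> real" where
  "fundamental_tensor K b u v = b (K u) v"

definition flat ::
  "('a, 'e::euclidean_space) chart set \<Rightarrow> (('a \<Rightarrow> 'e) \<Rightarrow> ('a \<Rightarrow> 'e) \<Rightarrow> 'a \<Rightarrow> real) \<Rightarrow>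
   ('a \<Rightarrow> 'e) \<Rightarrow> 'a \<Rightarrow> 'e \<Rightarrow>\<^sub>L real" where
  "flat A b X = (THE \<xi>. \<xi> \<in> one_forms A \<and> (\<forall>Y\<in>vector_fields A. pairing \<xi> Y = b X Y))"

definition sharp ::
  "('a, 'e::euclidean_space) chart set \<Rightarrow> (('a \<Rightarrow> 'e) \<Rightarrow> ('a \<Rightarrow> 'e) \<Rightarrow> 'a \<Rightarrow> real) \<Rightarrow>
   ('a \<Rightarrow> 'e \<Rightarrow>\<^sub>L real) \<Rightarrow> 'a \<Rightarrow> 'e" where
  "sharp A b = inv_into (vector_fields A) (flat A b)"


section \<open>Structures on the generalized tangent bundle\<close>

definition block ::
  "(('a \<Rightarrow> 'e) \<Rightarrow> 'a \<Rightarrow> 'e) \<Rightarrow> (('a \<Rightarrow> 'e \<Rightarrow>\<^sub>L real) \<Rightarrow> 'a \<Rightarrow> 'e) \<Rightarrow>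
   (('a \<Rightarrow> 'e) \<Rightarrow> 'a \<Rightarrow> 'e \<Rightarrow>\<^sub>L real) \<Rightarrow> (('a \<Rightarrow> 'e \<Rightarrow>\<^sub>L real) \<Rightarrow> 'a \<Rightarrow> 'e \<Rightarrow>\<^sub>L real) \<Rightarrow>
   ('a \<Rightarrow> 'e \<times> ('e \<Rightarrow>\<^sub>L real)) \<Rightarrow> 'a \<Rightarrow> 'e::euclidean_space \<times> ('e \<Rightarrow>\<^sub>L real)" where
  "block H \<sigma> \<tau> K u =
     gen_section (\<lambda>p. H (fst \<circ> u) p + \<sigma> (snd \<circ> u) p) (\<lambda>p. \<tau> (fst \<circ> u) p + K (snd \<circ> u) p)"

definition J_gen ::
  "('a, 'e::euclidean_space) chart set \<Rightarrow> (('a \<Rightarrow> 'e) \<Rightarrow> ('a \<Rightarrow> 'e) \<Rightarrow> 'a \<Rightarrow> real) \<Rightarrow>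
   ('a \<Rightarrow> 'e \<times> ('e \<Rightarrow>\<^sub>L real)) \<Rightarrow> 'a \<Rightarrow> 'e \<times> ('e \<Rightarrow>\<^sub>L real)" where
  "J_gen A b = block (\<lambda>X p. 0) (\<lambda>\<xi> p. - sharp A b \<xi> p) (flat A b) (\<lambda>\<xi> p. 0)"

definition F_gen ::
  "('a, 'e::euclidean_space) chart set \<Rightarrow> (('a \<Rightarrow> 'e) \<Rightarrow> ('a \<Rightarrow> 'e) \<Rightarrow> 'a \<Rightarrow> real) \<Rightarrow>
   ('a \<Rightarrow> 'e \<times> ('e \<Rightarrow>\<^sub>L real)) \<Rightarrow> 'a \<Rightarrow> 'e \<times> ('e \<Rightarrow>\<^sub>L real)" where
  "F_gen A b = block (\<lambda>X p. 0) (sharp A b) (flat A b) (\<lambda>\<xi> p. 0)"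

definition gen_metric ::
  "('a, 'e::euclidean_space) chart set \<Rightarrow> (('a \<Rightarrow> 'e) \<Rightarrow> ('a \<Rightarrow> 'e) \<Rightarrow> 'a \<Rightarrow> real) \<Rightarrow>
   ('a \<Rightarrow> 'e \<times> ('e \<Rightarrow>\<^sub>L real)) \<Rightarrow> ('a \<Rightarrow> 'e \<times> ('e \<Rightarrow>\<^sub>L real)) \<Rightarrow> 'a \<Rightarrow> real" where
  "gen_metric A g u v =
     (\<lambda>p. g (fst \<circ> u) (fst \<circ> v) p + g (sharp A g (snd \<circ> u)) (sharp A g (snd \<circ> v)) p)"

definition G0 ::
  "('a \<Rightarrow> 'e \<times> ('e \<Rightarrow>\<^sub>L real)) \<Rightarrow> ('a \<Rightarrow> 'e::euclidean_space \<times> ('e \<Rightarrow>\<^sub>L real)) \<Rightarrow> 'a \<Rightarrow> real" where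
  "G0 u v = (\<lambda>p. 1/2 * (pairing (snd \<circ> u) (fst \<circ> v) p + pairing (snd \<circ> v) (fst \<circ> u) p))"

definition Omega0 ::
  "('a \<Rightarrow> 'e \<times> ('e \<Rightarrow>\<^sub>L real)) \<Rightarrow> ('a \<Rightarrow> 'e::euclidean_space \<times> ('e \<Rightarrow>\<^sub>L real)) \<Rightarrow> 'a \<Rightarrow> real" where
  "Omega0 u v = (\<lambda>p. 1/2 * (pairing (snd \<circ> u) (fst \<circ> v) p - pairing (snd \<circ> v) (fst \<circ> u) p))"

text \<open>Fibre at \<open>p\<close> of the eigenbundle of \<open>K\<close> for the eigenvalue \<open>s\<close>.\<close>

definition eigenfibre ::
  "('a \<Rightarrow> 'v::real_vector) set \<Rightarrow> (('a \<Rightarrow> 'v) \<Rightarrow> 'a \<Rightarrow> 'v) \<Rightarrow> real \<Rightarrow> 'a \<Rightarrow> 'v set" where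
  "eigenfibre \<Gamma> K s p = {u p |u. u \<in> \<Gamma> \<and> K u = (\<lambda>q. s *\<^sub>R u q)}"

context
  fixes A :: "('a, 'e::euclidean_space) chart set"
    and K :: "('a \<Rightarrow> 'e \<times> ('e \<Rightarrow>\<^sub>L real)) \<Rightarrow> 'a \<Rightarrow> 'e \<times> ('e \<Rightarrow>\<^sub>L real)"
    and G :: "('a \<Rightarrow> 'e \<times> ('e \<Rightarrow>\<^sub>L real)) \<Rightarrow> ('a \<Rightarrow> 'e \<times> ('e \<Rightarrow>\<^sub>L real)) \<Rightarrow> 'a \<Rightarrow> real"
begin

definition gen_almost_hermitian :: bool where
  "gen_almost_hermitian \<longleftrightarrow>
     metric_structure A (gen_sections A) K G (-1) 1 \<and> riemannian A (gen_sections A) G"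

definition gen_indefinite_almost_hermitian :: bool where
  "gen_indefinite_almost_hermitian \<longleftrightarrow>
     metric_structure A (gen_sections A) K G (-1) 1 \<and> pseudo_riemannian A (gen_sections A) G"

definition gen_almost_norden :: bool where
  "gen_almost_norden \<longleftrightarrow> metric_structure A (gen_sections A) K G (-1) (-1)"

definition gen_almost_para_hermitian :: bool where
  "gen_almost_para_hermitian \<longleftrightarrow> metric_structure A (gen_sections A) K G 1 (-1)"

definition gen_pseudo_riemannian_almost_product :: bool where
  "gen_pseudo_riemannian_almost_product \<longleftrightarrow>
     metric_structure A (gen_sections A) K G 1 1 \<and> pseudo_riemannian A (gen_sections A) G"

definition gen_almost_para_norden :: bool where
  "gen_almost_para_norden \<longleftrightarrow>
     metric_structure A (gen_sections A) K G 1 1 \<and> riemannian A (gen_sections A) G \<and>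
     (\<forall>p. dim (eigenfibre (gen_sections A) K 1 p) = dim (eigenfibre (gen_sections A) K (-1) p))"

end

end

theory Submission imports Defs begin

text \<open>
  A map from vector fields to smooth functions that is linear over the smooth functions is
  evaluation of a one-form: it acts pointwise because vector fields can be decomposed in a frame
  cut off by a bump function. Hence \<open>\<flat>\<^sub>b\<close> is well defined, and for nondegenerate \<open>b\<close> it is
  bijective: fibrewise this is linear algebra, and in a chart the solution of a smooth invertible
  linear system is smooth, since its derivative solves a system with the same matrix.
  The rest is algebra: \<open>\<flat>\<^sub>\<phi> = \<flat>\<^sub>g \<circ> J\<close>, so \<open>J \<circ> \<sharp>\<^sub>\<phi> = \<sharp>\<^sub>g\<close>,
  and everything reduces to \<open>g(JX, JY) = \<epsilon> g(X, Y)\<close>. The two eigenbundles of \<open>\<F>\<^sub>\<phi>\<close> are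
  exchanged by \<open>X + \<xi> \<mapsto> X - \<xi>\<close>.
\<close>

section \<open>Differentiability of finite order\<close>

text \<open>Tensors act on global sections only, while smoothness is tested in charts. A chart-local
  object therefore has to be multiplied by a cut-off before a tensor accepts it, and the cut-off is
  divided out again near the point of interest; \<open>local_frame\<close> and
  \<open>smooth_at_cancel\<close> are these two halves. \<open>flat\<close> is a definite
  description and \<open>sharp\<close> a set-theoretic inverse, so neither can be computed with
  before existence, uniqueness and bijectivity are known. Surjectivity is the hard part:
  nondegeneracy gives a vector at each point, but choices made point by point say nothing about
  smoothness. The fibrewise solution is unique, however, and this yields first continuity, then a
  derivative, then every order, without any formula for an inverse matrix. \<open>Ck_on\<close>
  refers to the derivative in each fixed direction, which is again a function of the point, hence
  the inductions on the order generalise over the function.\<close>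

lemma Ck_on_cong:
  assumes "open S" "\<And>x. x \<in> S \<Longrightarrow> f x = g x" "Ck_on k S f"
  shows "Ck_on k S g"
  using assms(2,3)
proof (induction k arbitrary: f g)
  case 0
  then show ?case using continuous_on_cong[of S S f g] by auto
next
  case (Suc k)
  have der: "(g has_derivative frechet_derivative f (at x)) (at x)" if "x \<in> S" for x
  proof -
    have "(f has_derivative frechet_derivative f (at x)) (at x)"
      using Suc.prems(2) that by (auto simp: frechet_derivative_works)
    then show ?thesis
      using assms(1) that Suc.prems(1) by (rule has_derivative_transform_within_open)
  qed
  have "Ck_on k S (\<lambda>x. frechet_derivative g (at x) v)" for v
  proof (rule Suc.IH)
    show "frechet_derivative f (at x) v = frechet_derivative g (at x) v" if "x \<in> S" for x
      using frechet_derivative_at[OF der[OF that]] by simp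
    show "Ck_on k S (\<lambda>x. frechet_derivative f (at x) v)"
      using Suc.prems(2) by simp
  qed
  then show ?case
    using der by (auto simp: differentiable_def)
qed

text \<open>\<open>frechet_derivative\<close> is a choice, so a derivative produced by the calculus
  rules has to be identified with it on \<open>S\<close>. Doing this once lets the closure lemmas
  exhibit an explicit derivative.\<close>

lemma Ck_on_SucI:
  assumes "open S" "\<And>x. x \<in> S \<Longrightarrow> (f has_derivative f' x) (at x)"
    and "\<And>v. Ck_on k S (\<lambda>x. f' x v)"
  shows "Ck_on (Suc k) S f"
proof -
  have "Ck_on k S (\<lambda>x. frechet_derivative f (at x) v)" for v
    using assms(1) _ assms(3)[of v]
    by (rule Ck_on_cong) (use frechet_derivative_at[OF assms(2)] in simp)
  then show ?thesis
    using assms(2) by (auto simp: differentiable_def)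
qed

lemma Ck_on_Suc_has_derivative:
  assumes "Ck_on (Suc k) S f" "x \<in> S"
  shows "(f has_derivative frechet_derivative f (at x)) (at x)"
  using assms by (auto simp: frechet_derivative_works)

lemma Ck_on_subset: "Ck_on k S f \<Longrightarrow> T \<subseteq> S \<Longrightarrow> Ck_on k T f"
proof (induction k arbitrary: f)
  case 0
  then show ?case by (auto intro: continuous_on_subset)
next
  case (Suc k)
  then show ?case by auto
qed

text \<open>All derivatives are taken at points of the whole space, so the order can be tested on a
  different neighbourhood of each point. This is what allows gluing on the manifold.\<close>

lemma Ck_on_locally:
  assumes "\<And>x. x \<in> S \<Longrightarrow> \<exists>U. open U \<and> x \<in> U \<and> Ck_on k U f"
  shows "Ck_on k S f"
  using assms
proof (induction k arbitrary: f)
  case 0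
  then have "isCont f x" if "x \<in> S" for x
    using that by (metis Ck_on.simps(1) continuous_on_eq_continuous_at)
  then show ?case by (simp add: continuous_at_imp_continuous_on)
next
  case (Suc k)
  then show ?case by simp meson
qed

lemma Ck_on_lower: "Ck_on (Suc k) S f \<Longrightarrow> Ck_on k S f"
proof (induction k arbitrary: f)
  case 0
  then show ?case
    by (auto intro!: continuous_at_imp_continuous_on differentiable_imp_continuous_within)
next
  case (Suc k)
  then show ?case by (metis Ck_on.simps(2))
qed

lemma Ck_on_const: "open S \<Longrightarrow> Ck_on k S (\<lambda>x. c)"
proof (induction k arbitrary: c)
  case (Suc k)
  then show ?case by (intro Ck_on_SucI[where f' = "\<lambda>x v. 0"]) auto
qed auto

lemma Ck_on_bounded_linear:
  assumes "bounded_linear L" "open S"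
  shows "Ck_on k S L"
proof (cases k)
  case 0
  then show ?thesis using assms by (simp add: linear_continuous_on)
next
  case (Suc l)
  then show ?thesis
    using assms by (auto intro!: Ck_on_SucI[of S L "\<lambda>x. L" l] bounded_linear_imp_has_derivative
        Ck_on_const simp del: Ck_on.simps)
qed

lemma Ck_on_bounded_linear_compose:
  assumes "bounded_linear L" "open S" "Ck_on k S f"
  shows "Ck_on k S (\<lambda>x. L (f x))"
  using assms(3)
proof (induction k arbitrary: f)
  case 0
  then show ?case
    using assms(1) by (auto intro: bounded_linear.continuous_on)
next
  case (Suc k)
  show ?case
  proof (rule Ck_on_SucI[OF assms(2)])
    show "((\<lambda>x. L (f x)) has_derivative (\<lambda>v. L (frechet_derivative f (at x) v))) (at x)"
      if "x \<in> S" for x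
      by (rule bounded_linear.has_derivative[OF assms(1) Ck_on_Suc_has_derivative[OF Suc.prems that]])
    show "Ck_on k S (\<lambda>x. L (frechet_derivative f (at x) v))" for v
      using Suc.prems by (intro Suc.IH) simp
  qed
qed

lemma Ck_on_add:
  assumes "open S" "Ck_on k S f" "Ck_on k S g"
  shows "Ck_on k S (\<lambda>x. f x + g x)"
  using assms(2,3)
proof (induction k arbitrary: f g)
  case 0
  then show ?case by (auto intro: continuous_on_add)
next
  case (Suc k)
  show ?case
  proof (rule Ck_on_SucI[OF assms(1)])
    show "((\<lambda>x. f x + g x) has_derivative
        (\<lambda>v. frechet_derivative f (at x) v + frechet_derivative g (at x) v)) (at x)"
      if "x \<in> S" for x
      by (rule has_derivative_add[OF Ck_on_Suc_has_derivative[OF Suc.prems(1) that]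
            Ck_on_Suc_has_derivative[OF Suc.prems(2) that]])
    show "Ck_on k S (\<lambda>x. frechet_derivative f (at x) v + frechet_derivative g (at x) v)" for v
      using Suc.prems by (intro Suc.IH) simp_all
  qed
qed

lemma Ck_on_sum:
  assumes "open S" "\<And>i. i \<in> I \<Longrightarrow> Ck_on k S (f i)"
  shows "Ck_on k S (\<lambda>x. \<Sum>i\<in>I. f i x)"
  using assms(2)
  by (induction I rule: infinite_finite_induct) (auto intro: Ck_on_const Ck_on_add assms(1))

lemma Ck_on_scaleR:
  assumes "open S" "Ck_on k S f" "Ck_on k S g"
  shows "Ck_on k S (\<lambda>x. f x *\<^sub>R g x)"
  using assms(2,3)
proof (induction k arbitrary: f g)
  case 0
  then show ?case by (auto intro: continuous_on_scaleR)
next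
  case (Suc k)
  \<comment> \<open>The product rule brings back \<open>f\<close> and \<open>g\<close> themselves,
    next to derivatives that are only of order \<open>k\<close>.\<close>
  have lower: "Ck_on k S f" "Ck_on k S g"
    using Suc.prems by (auto dest: Ck_on_lower simp del: Ck_on.simps)
  show ?case
  proof (rule Ck_on_SucI[OF assms(1)])
    show "((\<lambda>x. f x *\<^sub>R g x) has_derivative
        (\<lambda>v. f x *\<^sub>R frechet_derivative g (at x) v + frechet_derivative f (at x) v *\<^sub>R g x)) (at x)"
      if "x \<in> S" for x
      by (rule has_derivative_scaleR[OF Ck_on_Suc_has_derivative[OF Suc.prems(1) that]
            Ck_on_Suc_has_derivative[OF Suc.prems(2) that]])
    show "Ck_on k S (\<lambda>x. f x *\<^sub>R frechet_derivative g (at x) v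
        + frechet_derivative f (at x) v *\<^sub>R g x)" for v
      using Suc.prems lower by (intro Ck_on_add assms(1) Suc.IH) simp_all
  qed
qed

lemma linear_eq_sum_Basis:
  fixes L :: "'e::euclidean_space \<Rightarrow> 'f::real_vector"
  assumes "linear L"
  shows "L u = (\<Sum>b\<in>Basis. (u \<bullet> b) *\<^sub>R L b)"
proof -
  have "L u = L (\<Sum>b\<in>Basis. (u \<bullet> b) *\<^sub>R b)"
    by (simp add: euclidean_representation)
  also have "\<dots> = (\<Sum>b\<in>Basis. (u \<bullet> b) *\<^sub>R L b)"
    using assms by (simp add: linear_sum linear_scale)
  finally show ?thesis .
qed

text \<open>The chain rule evaluates the outer derivative in a direction that varies with the point.
  Expanding this direction in \<open>Basis\<close> leaves a finite sum of products in which the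
  outer derivative is taken in fixed directions, so the induction hypothesis applies to it.\<close>

lemma Ck_on_compose:
  fixes f :: "'e::euclidean_space \<Rightarrow> 'f::real_normed_vector" and g :: "'d::euclidean_space \<Rightarrow> 'e"
  assumes "open S" "open T" "g ` S \<subseteq> T" "Ck_on k T f" "Ck_on k S g"
  shows "Ck_on k S (\<lambda>x. f (g x))"
  using assms(4,5)
proof (induction k arbitrary: f)
  case 0
  then show ?case
    using assms(3) by (auto intro: continuous_on_compose2)
next
  case (Suc k)
  let ?D = "\<lambda>x v. \<Sum>b\<in>Basis.
    (frechet_derivative g (at x) v \<bullet> b) *\<^sub>R frechet_derivative f (at (g x)) b"
  have "((\<lambda>x. f (g x)) has_derivative ?D x) (at x)" if "x \<in> S" for x
  proof -
    have f: "(f has_derivative frechet_derivative f (at (g x))) (at (g x))"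
      using Suc.prems(1) that assms(3) by (intro Ck_on_Suc_has_derivative) auto
    have "((\<lambda>x. f (g x)) has_derivative (\<lambda>v. frechet_derivative f (at (g x)) (frechet_derivative g (at x) v))) (at x)"
      using has_derivative_compose[OF Ck_on_Suc_has_derivative[OF Suc.prems(2) that] f] .
    then show ?thesis
      by (subst (asm) linear_eq_sum_Basis[OF has_derivative_linear[OF f]])
  qed
  moreover have "Ck_on k S (\<lambda>x. ?D x v)" for v
  proof (intro Ck_on_sum Ck_on_scaleR assms(1))
    fix b :: 'e
    show "Ck_on k S (\<lambda>x. frechet_derivative g (at x) v \<bullet> b)"
      using Suc.prems(2)
      by (intro Ck_on_bounded_linear_compose[OF bounded_linear_inner_left] assms(1)) simp
    show "Ck_on k S (\<lambda>x. frechet_derivative f (at (g x)) b)"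
      using Suc.prems by (intro Suc.IH Ck_on_lower[OF Suc.prems(2)]) simp
  qed
  ultimately show ?case
    by (rule Ck_on_SucI[OF assms(1)])
qed

section \<open>Linear systems with smooth coefficients\<close>

lemma has_derivative_scaleR_vanishing:
  fixes f :: "'e::real_normed_vector \<Rightarrow> real" and h :: "'e \<Rightarrow> 'f::real_normed_vector"
  assumes "isCont f x" "(h has_derivative h') (at x)" "h x = 0"
  shows "((\<lambda>y. f y *\<^sub>R h y) has_derivative (\<lambda>v. f x *\<^sub>R h' v)) (at x)"
proof -
  obtain K where K: "\<And>v. norm (h' v) \<le> norm v * K"
    using bounded_linear.bounded[OF has_derivative_bounded_linear[OF assms(2)]] by blast
  let ?r = "\<lambda>y. norm (h y - h x - h' (y - x)) / norm (y - x)"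
  have lin: "bounded_linear (\<lambda>v. f x *\<^sub>R h' v)"
    using has_derivative_bounded_linear[OF assms(2)] by (rule bounded_linear_const_scaleR)
  have r: "(?r \<longlongrightarrow> 0) (at x)"
    using assms(2) by (simp add: has_derivative_iff_norm)
  have f: "(f \<longlongrightarrow> f x) (at x)"
    using assms(1) by (simp add: isCont_def)
  have "((\<lambda>y. \<bar>f y\<bar> * ?r y + \<bar>f y - f x\<bar> * K) \<longlongrightarrow> \<bar>f x\<bar> * 0 + \<bar>f x - f x\<bar> * K) (at x)"
    by (intro tendsto_intros f r)
  then have lim: "((\<lambda>y. \<bar>f y\<bar> * ?r y + \<bar>f y - f x\<bar> * K) \<longlongrightarrow> 0) (at x)"
    by simp
  have "((\<lambda>y. norm (f y *\<^sub>R h y - f x *\<^sub>R h x - f x *\<^sub>R h' (y - x)) / norm (y - x)) \<longlongrightarrow> 0) (at x)"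
  proof (rule Lim_null_comparison[OF _ lim], rule eventuallyI)
    fix y
    show "norm (norm (f y *\<^sub>R h y - f x *\<^sub>R h x - f x *\<^sub>R h' (y - x)) / norm (y - x))
      \<le> \<bar>f y\<bar> * ?r y + \<bar>f y - f x\<bar> * K"
    proof (cases "y = x")
      case False
      \<comment> \<open>Because \<open>h x = 0\<close>, the increment of \<open>f\<close> is
        multiplied only by \<open>h' (y - x)\<close>, and continuity of \<open>f\<close> makes that
        term negligible. In the application \<open>f\<close> is a coordinate of a solution known
        only to be continuous.\<close>
      have "norm (f y *\<^sub>R h y - f x *\<^sub>R h x - f x *\<^sub>R h' (y - x))
        = norm (f y *\<^sub>R (h y - h x - h' (y - x)) + (f y - f x) *\<^sub>R h' (y - x))"
        using assms(3) by (simp add: algebra_simps)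
      also have "\<dots> \<le> \<bar>f y\<bar> * norm (h y - h x - h' (y - x)) + \<bar>f y - f x\<bar> * norm (h' (y - x))"
        by (metis norm_scaleR norm_triangle_ineq)
      also have "\<dots> \<le> \<bar>f y\<bar> * norm (h y - h x - h' (y - x)) + \<bar>f y - f x\<bar> * (norm (y - x) * K)"
        by (intro add_left_mono mult_left_mono K) auto
      finally show ?thesis
        using False by (simp add: divide_simps) (simp add: algebra_simps)
    qed auto
  qed
  then show ?thesis
    using lin by (simp add: has_derivative_iff_norm)
qed

text \<open>Injectivity of \<open>L x\<close> gives a lower bound
  \<open>B * norm v \<le> norm (L x v)\<close>, which survives for nearby \<open>L y\<close> with
  \<open>B/2\<close>. Applied to \<open>X y - X x\<close> it bounds this difference by the residual
  of the constant candidate \<open>X x\<close>, which tends to 0.\<close>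

lemma isCont_solution:
  fixes L :: "'d::euclidean_space \<Rightarrow> 'e::euclidean_space \<Rightarrow> 'e"
  assumes "open S" "x \<in> S"
    and lin: "\<And>y. y \<in> S \<Longrightarrow> linear (L y)" and inj: "inj (L x)"
    and cont: "\<And>v. isCont (\<lambda>y. L y v) x" "isCont \<xi> x"
    and eq: "\<And>y. y \<in> S \<Longrightarrow> L y (X y) = \<xi> y"
  shows "isCont X x"
proof -
  obtain B where B: "B > 0" "\<And>v. B * norm v \<le> norm (L x v)"
    using linear_inj_bounded_below_pos[OF lin[OF assms(2)] inj] by blast
  \<comment> \<open>A bound for the operator norm of \<open>L y - L x\<close>, built from finitely
    many columns because continuity is assumed for each fixed vector only.\<close>
  let ?N = "\<lambda>y. \<Sum>b\<in>Basis. norm (L y b - L x b)"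
  have N: "norm (L y v - L x v) \<le> ?N y * norm v" if "y \<in> S" for y v
  proof -
    have "L y v - L x v = (\<Sum>b\<in>Basis. (v \<bullet> b) *\<^sub>R (L y b - L x b))"
      unfolding linear_eq_sum_Basis[OF lin[OF that], of v] linear_eq_sum_Basis[OF lin[OF assms(2)], of v]
      by (simp add: scaleR_right_diff_distrib sum_subtractf)
    also have "norm \<dots> \<le> (\<Sum>b\<in>Basis. norm v * norm (L y b - L x b))"
      by (intro sum_norm_le) (simp add: Basis_le_norm mult_right_mono)
    finally show ?thesis by (simp add: sum_distrib_left mult.commute)
  qed
  have "((\<lambda>y. ?N y) \<longlongrightarrow> (\<Sum>b\<in>Basis. norm (L x b - L x b))) (at x)"
    using cont by (intro tendsto_intros) (auto simp: isCont_def)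
  then have "((\<lambda>y. ?N y) \<longlongrightarrow> 0) (at x)"
    by simp
  then have ev1: "\<forall>\<^sub>F y in at x. ?N y < B/2"
    using B(1) by (intro order_tendstoD) auto
  have ev2: "\<forall>\<^sub>F y in at x. y \<in> S"
    using assms(1,2) by (simp add: eventually_at_in_open')
  have "((\<lambda>y. 2 / B * norm (\<xi> y - L y (X x))) \<longlongrightarrow> 2 / B * norm (\<xi> x - L x (X x))) (at x)"
    using cont by (intro tendsto_intros) (auto simp: isCont_def)
  then have lim: "((\<lambda>y. 2 / B * norm (\<xi> y - L y (X x))) \<longlongrightarrow> 0) (at x)"
    using eq[OF assms(2)] by simp
  have "((\<lambda>y. X y - X x) \<longlongrightarrow> 0) (at x)"
  proof (rule Lim_null_comparison[OF _ lim])
    show "\<forall>\<^sub>F y in at x. norm (X y - X x) \<le> 2 / B * norm (\<xi> y - L y (X x))"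
      using ev1 ev2
    proof eventually_elim
      case (elim y)
      let ?d = "X y - X x"
      have "B * norm ?d \<le> norm (L x ?d)"
        by (rule B)
      also have "\<dots> \<le> norm (L y ?d) + norm (L y ?d - L x ?d)"
        using norm_triangle_ineq4[of "L y ?d" "L y ?d - L x ?d"] by simp
      also have "norm (L y ?d - L x ?d) \<le> B/2 * norm ?d"
        using N[OF elim(2), of ?d] elim(1) by (meson less_imp_le mult_right_mono norm_ge_zero order_trans)
      also have "L y ?d = \<xi> y - L y (X x)"
        using lin[OF elim(2)] eq[OF elim(2)] by (simp add: linear_diff)
      finally have "B * norm ?d \<le> 2 * norm (\<xi> y - L y (X x))" by simp
      then show ?case using B(1) by (simp add: field_simps)
    qed
  qed
  then show ?thesis
    by (simp add: isCont_def LIM_zero_iff)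
qed

text \<open>The system is rewritten as \<open>L x (X y) = \<xi> y - (L y (X y) - L x (X y))\<close>,
  with a fixed matrix on the left. On the right the unknown occurs only as a factor of
  \<open>L y b - L x b\<close>, which vanishes at \<open>x\<close>, so continuity of
  \<open>X\<close> is enough to differentiate.\<close>

lemma has_derivative_solution:
  fixes L :: "'d::euclidean_space \<Rightarrow> 'e::euclidean_space \<Rightarrow> 'e"
  assumes "open S" "x \<in> S"
    and lin: "\<And>y. y \<in> S \<Longrightarrow> linear (L y)" and inj: "inj (L x)"
    and der: "\<And>v. ((\<lambda>y. L y v) has_derivative L' v) (at x)" "(\<xi> has_derivative \<xi>') (at x)"
    and eq: "\<And>y. y \<in> S \<Longrightarrow> L y (X y) = \<xi> y"
  shows "\<exists>X'. (X has_derivative X') (at x) \<and>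
    (\<forall>v. L x (X' v) = \<xi>' v - (\<Sum>b\<in>Basis. (X x \<bullet> b) *\<^sub>R L' b v))"
proof -
  have X: "isCont X x"
    using assms(1-4) eq has_derivative_continuous[OF der(1)] has_derivative_continuous[OF der(2)]
    by (intro isCont_solution[of S x L \<xi> X]) auto
  obtain M where M: "linear M" "M \<circ> L x = id"
    using linear_injective_left_inverse[OF lin[OF assms(2)] inj] by blast
  have LM: "L x (M v) = v" for v
  proof -
    obtain w where "v = L x w"
      using linear_injective_imp_surjective[OF lin[OF assms(2)] inj refl] by (rule surjE)
    then show ?thesis
      using fun_cong[OF M(2), of w] by simp
  qed
  let ?R' = "\<lambda>v. \<xi>' v - (\<Sum>b\<in>Basis. (X x \<bullet> b) *\<^sub>R L' b v)"
  have "((\<lambda>y. \<xi> y - (\<Sum>b\<in>Basis. (X y \<bullet> b) *\<^sub>R (L y b - L x b))) has_derivative ?R') (at x)"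
  proof (rule has_derivative_diff[OF der(2)], rule has_derivative_sum)
    fix b :: 'e
    have "((\<lambda>y. L y b - L x b) has_derivative L' b) (at x)"
      using has_derivative_diff[OF der(1)[of b] has_derivative_const[of "L x b"]] by simp
    moreover have "isCont (\<lambda>y. X y \<bullet> b) x"
      using X by (intro continuous_intros)
    ultimately show "((\<lambda>y. (X y \<bullet> b) *\<^sub>R (L y b - L x b)) has_derivative
        (\<lambda>v. (X x \<bullet> b) *\<^sub>R L' b v)) (at x)"
      by (intro has_derivative_scaleR_vanishing) auto
  qed
  then have "((\<lambda>y. M (\<xi> y - (\<Sum>b\<in>Basis. (X y \<bullet> b) *\<^sub>R (L y b - L x b)))) has_derivative (\<lambda>v. M (?R' v))) (at x)"
    using M(1) by (rule bounded_linear.has_derivative[OF linear_conv_bounded_linear[THEN iffD1], rotated])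
  moreover have "M (\<xi> y - (\<Sum>b\<in>Basis. (X y \<bullet> b) *\<^sub>R (L y b - L x b))) = X y" if "y \<in> S" for y
  proof -
    have "\<xi> y - (\<Sum>b\<in>Basis. (X y \<bullet> b) *\<^sub>R (L y b - L x b))
      = \<xi> y - ((\<Sum>b\<in>Basis. (X y \<bullet> b) *\<^sub>R L y b) - (\<Sum>b\<in>Basis. (X y \<bullet> b) *\<^sub>R L x b))"
      by (simp add: scaleR_right_diff_distrib sum_subtractf)
    also have "\<dots> = \<xi> y - (L y (X y) - L x (X y))"
      using linear_eq_sum_Basis[OF lin[OF that], of "X y"]
        linear_eq_sum_Basis[OF lin[OF assms(2)], of "X y"] by simp
    also have "\<dots> = L x (X y)"
      using eq[OF that] by simp
    finally show ?thesis
      using fun_cong[OF M(2), of "X y"] by simp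
  qed
  ultimately have "(X has_derivative (\<lambda>v. M (?R' v))) (at x)"
    using assms(1,2) by (elim has_derivative_transform_within_open) auto
  then show ?thesis
    using LM by blast
qed

text \<open>Each directional derivative of \<open>X\<close> solves the system with the same
  \<open>L\<close> and the right-hand side \<open>?R\<close>, which is of order \<open>k\<close>
  once \<open>X\<close> is. So the induction hypothesis is used twice, for \<open>X\<close> and for
  its derivative.\<close>

lemma Ck_on_solution:
  fixes L :: "'d::euclidean_space \<Rightarrow> 'e::euclidean_space \<Rightarrow> 'e"
  assumes "open S" and lin: "\<And>y. y \<in> S \<Longrightarrow> linear (L y)" and inj: "\<And>y. y \<in> S \<Longrightarrow> inj (L y)"
    and "\<And>v. Ck_on k S (\<lambda>y. L y v)" "Ck_on k S \<xi>" "\<And>y. y \<in> S \<Longrightarrow> L y (X y) = \<xi> y"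
  shows "Ck_on k S X"
  using assms(4-6)
proof (induction k arbitrary: X \<xi>)
  case 0
  then show ?case
    using assms(1) lin inj
    by (auto simp: continuous_on_eq_continuous_at intro!: isCont_solution[of S _ L \<xi> X])
next
  case (Suc k)
  let ?L' = "\<lambda>x b v. frechet_derivative (\<lambda>y. L y b) (at x) v"
  let ?R = "\<lambda>x v. frechet_derivative \<xi> (at x) v - (\<Sum>b\<in>Basis. (X x \<bullet> b) *\<^sub>R ?L' x b v)"
  define X' where "X' x = frechet_derivative X (at x)" for x
  have sol: "(X has_derivative X' x) (at x) \<and> (\<forall>v. L x (X' x v) = ?R x v)" if "x \<in> S" for x
  proof -
    have "\<exists>D. (X has_derivative D) (at x) \<and> (\<forall>v. L x (D v) = ?R x v)"
      using Suc.prems that assms(1) lin inj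
      by (intro has_derivative_solution[of S]) (auto simp: frechet_derivative_works[symmetric])
    then obtain D where D: "(X has_derivative D) (at x)" "\<forall>v. L x (D v) = ?R x v"
      by blast
    then show ?thesis
      using frechet_derivative_at[OF D(1)] by (simp add: X'_def)
  qed
  have X': "\<And>x. x \<in> S \<Longrightarrow> (X has_derivative X' x) (at x)"
      "\<And>x v. x \<in> S \<Longrightarrow> L x (X' x v) = ?R x v"
    using sol by blast+
  have L: "Ck_on k S (\<lambda>y. L y v)" for v
    using Suc.prems(1) by (rule Ck_on_lower)
  have X: "Ck_on k S X"
    by (rule Suc.IH[OF L Ck_on_lower[OF Suc.prems(2)] Suc.prems(3)])
  have "Ck_on k S (\<lambda>x. X' x v)" for v
  proof (rule Suc.IH[OF L _ X'(2)])
    \<comment> \<open>The minus sign of the sum in \<open>?R\<close> is moved into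
      \<open>- b\<close>, so that closure under sums and products suffices.\<close>
    have "Ck_on k S (\<lambda>x. X x \<bullet> - b)" for b
      by (rule Ck_on_bounded_linear_compose[OF bounded_linear_inner_left assms(1) X])
    moreover have "Ck_on k S (\<lambda>x. ?L' x b v)" for b
      using Suc.prems(1)[of b] by simp
    moreover have "Ck_on k S (\<lambda>x. frechet_derivative \<xi> (at x) v)"
      using Suc.prems(2) by simp
    ultimately have "Ck_on k S (\<lambda>x. frechet_derivative \<xi> (at x) v + (\<Sum>b\<in>Basis. (X x \<bullet> - b) *\<^sub>R ?L' x b v))"
      by (intro Ck_on_add Ck_on_sum Ck_on_scaleR assms(1))
    then show "Ck_on k S (\<lambda>x. ?R x v)"
      by (simp add: sum_negf)
  qed
  then show ?case
    using X'(1) by (intro Ck_on_SucI[OF assms(1)])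
qed

text \<open>The reciprocal solves the one-dimensional linear system with matrix \<open>f x\<close>
  and right-hand side 1.\<close>

lemma Ck_on_inverse:
  fixes f :: "'e::euclidean_space \<Rightarrow> real"
  assumes "open S" "Ck_on k S f" "\<And>x. x \<in> S \<Longrightarrow> f x \<noteq> 0"
  shows "Ck_on k S (\<lambda>x. inverse (f x))"
proof (rule Ck_on_solution[where L = "\<lambda>x v. f x * v" and \<xi> = "\<lambda>x. 1"])
  show "Ck_on k S (\<lambda>x. f x * v)" for v
    by (rule Ck_on_bounded_linear_compose[OF bounded_linear_mult_left assms(1,2)])
qed (use assms in \<open>auto simp: inj_on_def intro: Ck_on_const linearI simp: algebra_simps\<close>)

section \<open>A smooth bump function\<close>

definition exp_flat :: "nat \<Rightarrow> real \<Rightarrow> real" where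
  "exp_flat m t = (if t > 0 then inverse t ^ m / exp (inverse t) else 0)"

lemma exp_flat_tendsto_0: "(exp_flat m \<longlongrightarrow> 0) (at 0)"
proof -
  have "((\<lambda>t. inverse t ^ m / exp (inverse t)) \<longlongrightarrow> (0::real)) (at_right 0)"
    by (rule filterlim_compose[OF tendsto_power_div_exp_0 filterlim_inverse_at_top_right])
  then have "(exp_flat m \<longlongrightarrow> 0) (at_right 0)"
    by (rule Lim_transform_eventually) (auto simp: exp_flat_def eventually_at_filter)
  moreover have "(exp_flat m \<longlongrightarrow> 0) (at_left 0)"
    by (rule Lim_transform_eventually[OF tendsto_const]) (auto simp: exp_flat_def eventually_at_filter)
  ultimately show ?thesis
    by (simp add: filterlim_split_at)
qed

text \<open>The functions t^(-m) exp(-1/t), extended by 0, have derivatives that are linear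
  combinations of members of the same family. The index \<open>m\<close> serves this closure; the
  bump itself uses \<open>exp_flat 0\<close>.\<close>

lemma exp_flat_has_derivative:
  "(exp_flat m has_field_derivative (exp_flat (m + 2) t - m * exp_flat (m + 1) t)) (at t)"
proof -
  consider "t > 0" | "t < 0" | "t = 0" by linarith
  then show ?thesis
  proof cases
    case 1
    have "((\<lambda>t. inverse t ^ m / exp (inverse t)) has_field_derivative
      (exp_flat (m + 2) t - m * exp_flat (m + 1) t)) (at t)"
      using 1
      by (auto intro!: derivative_eq_intros simp: exp_flat_def)
         (cases m; simp add: field_simps power2_eq_square)
    then show ?thesis
      by (rule has_field_derivative_transform_within_open[where S = "{0<..}"])
         (use 1 in \<open>auto simp: exp_flat_def\<close>)
  next
    case 2
    have "((\<lambda>t. 0) has_field_derivative (exp_flat (m + 2) t - m * exp_flat (m + 1) t)) (at t)"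
      using 2 by (simp add: exp_flat_def)
    then show ?thesis
      by (rule has_field_derivative_transform_within_open[where S = "{..<0}"])
         (use 2 in \<open>auto simp: exp_flat_def\<close>)
  next
    case 3
    \<comment> \<open>The difference quotient at 0 is \<open>exp_flat (Suc m)\<close>, one power
      higher, which still tends to 0.\<close>
    have "((\<lambda>y. (exp_flat m y - exp_flat m 0) / (y - 0)) \<longlongrightarrow> 0) (at 0)"
      using exp_flat_tendsto_0[of "Suc m"]
      by (rule Lim_transform_eventually)
         (auto simp: exp_flat_def eventually_at_filter field_simps)
    then show ?thesis
      using 3 by (simp add: has_field_derivative_iff exp_flat_def)
  qed
qed

lemma Ck_on_exp_flat: "Ck_on k UNIV (exp_flat m)"
proof (induction k arbitrary: m)
  case 0
  show ?case
    using exp_flat_has_derivative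
    by (auto intro!: continuous_at_imp_continuous_on DERIV_isCont)
next
  case (Suc k)
  have "Ck_on k UNIV (\<lambda>t. v *\<^sub>R exp_flat (m + 2) t + (- real m * v) *\<^sub>R exp_flat (m + 1) t)" for v
    by (intro Ck_on_add Ck_on_scaleR Ck_on_const Suc.IH) auto
  then have "Ck_on k UNIV (\<lambda>t. (exp_flat (m + 2) t - m * exp_flat (m + 1) t) * v)" for v
    by (simp add: algebra_simps)
  then show ?case
    using exp_flat_has_derivative
    by (intro Ck_on_SucI[where f' = "\<lambda>t v. (exp_flat (m + 2) t - m * exp_flat (m + 1) t) * v"])
       (auto simp: has_field_derivative_def)
qed

lemma bump_function:
  fixes x :: "'e::euclidean_space"
  assumes "r > 0"
  obtains f :: "'e \<Rightarrow> real" where "smooth_on UNIV f" "f x \<noteq> 0" "\<And>y. y \<notin> cball x r \<Longrightarrow> f y = 0"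
proof
  \<comment> \<open>The argument is \<open>r\<^sup>2 - (norm (y - x))\<^sup>2\<close>, positive
    exactly in the open ball. Written as a sum of products of coordinates it falls under the closure
    lemmas.\<close>
  let ?f = "\<lambda>y. exp_flat 0 (r\<^sup>2 + (\<Sum>b\<in>Basis. - (((y - x) \<bullet> b) *\<^sub>R ((y - x) \<bullet> b))))"
  have norm: "(\<Sum>b\<in>Basis. - (((y - x) \<bullet> b) *\<^sub>R ((y - x) \<bullet> b))) = - (norm (y - x))\<^sup>2" for y
    by (simp add: sum_negf power2_norm_eq_inner euclidean_inner[of "y - x" "y - x"])
  have "Ck_on k UNIV (\<lambda>y. (y - x) \<bullet> b)" for k and b :: 'e
  proof -
    have "Ck_on k UNIV (\<lambda>y. y \<bullet> b + - (x \<bullet> b))"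
      by (intro Ck_on_add Ck_on_const Ck_on_bounded_linear[OF bounded_linear_inner_left]) auto
    then show ?thesis by (simp add: inner_diff_left)
  qed
  then have "Ck_on k UNIV (\<lambda>y. r\<^sup>2 + (\<Sum>b\<in>Basis. - (((y - x) \<bullet> b) *\<^sub>R ((y - x) \<bullet> b))))" for k
    by (intro Ck_on_add Ck_on_const Ck_on_sum Ck_on_scaleR
        Ck_on_bounded_linear_compose[OF bounded_linear_minus[OF bounded_linear_ident]]) auto
  then show "smooth_on UNIV ?f"
    unfolding smooth_on_def
    using Ck_on_compose[OF open_UNIV open_UNIV subset_UNIV Ck_on_exp_flat] by blast
  show "?f x \<noteq> 0"
    using assms by (simp add: exp_flat_def)
  show "?f y = 0" if "y \<notin> cball x r" for y
  proof -
    have "r\<^sup>2 \<le> (norm (y - x))\<^sup>2"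
      using that assms by (intro power_mono) (auto simp: dist_norm norm_minus_commute)
    then show ?thesis
      unfolding norm by (simp add: exp_flat_def)
  qed
qed

section \<open>Manifolds\<close>

lemma smooth_on_cong:
  "open S \<Longrightarrow> (\<And>x. x \<in> S \<Longrightarrow> f x = g x) \<Longrightarrow> smooth_on S f \<Longrightarrow> smooth_on S g"
  unfolding smooth_on_def by (blast intro: Ck_on_cong)

lemma smooth_on_subset: "smooth_on S f \<Longrightarrow> T \<subseteq> S \<Longrightarrow> smooth_on T f"
  unfolding smooth_on_def by (blast intro: Ck_on_subset)

lemma smooth_on_locally:
  "(\<And>x. x \<in> S \<Longrightarrow> \<exists>U. open U \<and> x \<in> U \<and> smooth_on U f) \<Longrightarrow> smooth_on S f"
  unfolding smooth_on_def by (intro allI Ck_on_locally) blast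

lemma smooth_on_compose:
  assumes "open S" "open T" "g ` S \<subseteq> T" "smooth_on T f" "smooth_on S g"
  shows "smooth_on S (f \<circ> g)"
  using assms unfolding smooth_on_def comp_def by (blast intro: Ck_on_compose)

lemma smooth_on_has_derivative:
  assumes "smooth_on S f" "x \<in> S"
  shows "(f has_derivative frechet_derivative f (at x)) (at x)"
  using assms Ck_on_Suc_has_derivative unfolding smooth_on_def by blast

lemma smooth_on_frechet_derivative:
  "smooth_on S f \<Longrightarrow> smooth_on S (\<lambda>x. frechet_derivative f (at x) v)"
  unfolding smooth_on_def using Ck_on.simps(2) by blast

section \<open>Charts and coordinate changes\<close>

locale smooth_manifold =
  fixes A :: "('a::{t2_space, second_countable_topology}, 'e::euclidean_space) chart set"
  assumes atlas: "smooth_atlas A"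
begin

lemma chart_facts:
  assumes "c \<in> A"
  shows open_chart_domain: "open (fst c)" and open_chart_image: "open (chart_image c)"
    and chart_homeomorphism: "homeomorphism (fst c) (chart_image c) (snd c) (chart_inv c)"
  using atlas assms unfolding smooth_atlas_def by blast+

lemma chart_inv_chart: "c \<in> A \<Longrightarrow> p \<in> fst c \<Longrightarrow> chart_inv c (snd c p) = p"
  using chart_homeomorphism by (metis homeomorphism_apply1)

lemma open_chart_image_of:
  assumes "c \<in> A" "open U" "U \<subseteq> fst c"
  shows "open (snd c ` U)"
proof -
  have "openin (top_of_set (chart_image c)) (snd c ` U)"
    using homeomorphism_imp_open_map[OF chart_homeomorphism[OF assms(1)]] assms(2,3)
    by (simp add: open_subset)
  then show ?thesis
    using open_chart_image[OF assms(1)] openin_open_trans by blast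
qed

lemma open_chart_preimage:
  assumes "c \<in> A" "open W"
  shows "open (fst c \<inter> snd c -` W)"
  using chart_homeomorphism[OF assms(1)] open_chart_domain[OF assms(1)] assms(2)
  by (auto simp: homeomorphism_def intro: continuous_open_preimage)

lemma chart_at_props: "chart_at A p \<in> A" "p \<in> fst (chart_at A p)"
proof -
  have "\<exists>c. c \<in> A \<and> p \<in> fst c"
    using atlas unfolding smooth_atlas_def by blast
  then have "chart_at A p \<in> A \<and> p \<in> fst (chart_at A p)"
    unfolding chart_at_def by (rule someI_ex)
  then show "chart_at A p \<in> A" "p \<in> fst (chart_at A p)" by auto
qed

lemma smooth_transition:
  "c \<in> A \<Longrightarrow> d \<in> A \<Longrightarrow> smooth_on (snd c ` (fst c \<inter> fst d)) (snd d \<circ> chart_inv c)"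
  using atlas unfolding smooth_atlas_def by blast

lemma open_overlap: "c \<in> A \<Longrightarrow> d \<in> A \<Longrightarrow> open (snd c ` (fst c \<inter> fst d))"
  by (intro open_chart_image_of open_Int open_chart_domain) auto

text \<open>\<open>tangent_to_chart\<close> and \<open>tangent_of_chart\<close> are the instances
  with \<open>chart_at A p\<close> as source or target. That they are inverse to each other is then
  the cocycle rule \<open>jacobian_chain\<close> together with \<open>jacobian_refl\<close>.\<close>

definition jacobian :: "('a, 'e) chart \<Rightarrow> ('a, 'e) chart \<Rightarrow> 'a \<Rightarrow> 'e \<Rightarrow> 'e" where
  "jacobian c d p = frechet_derivative (snd d \<circ> chart_inv c) (at (snd c p))"

lemma has_derivative_transition:
  assumes "c \<in> A" "d \<in> A" "p \<in> fst c" "p \<in> fst d"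
  shows "((snd d \<circ> chart_inv c) has_derivative jacobian c d p) (at (snd c p))"
  unfolding jacobian_def using assms
  by (intro smooth_on_has_derivative[OF smooth_transition]) auto

lemma linear_jacobian:
  assumes "c \<in> A" "d \<in> A" "p \<in> fst c" "p \<in> fst d"
  shows "linear (jacobian c d p)"
  using has_derivative_linear[OF has_derivative_transition[OF assms]] .

lemma jacobian_chain:
  assumes "c \<in> A" "d \<in> A" "e \<in> A" "p \<in> fst c" "p \<in> fst d" "p \<in> fst e"
  shows "jacobian d e p (jacobian c d p v) = jacobian c e p v"
proof -
  have d: "(snd d \<circ> chart_inv c) (snd c p) = snd d p"
    using assms by (simp add: chart_inv_chart)
  have "((snd e \<circ> chart_inv d) \<circ> (snd d \<circ> chart_inv c) has_derivative
      jacobian d e p \<circ> jacobian c d p) (at (snd c p))"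
    by (rule diff_chain_at[OF has_derivative_transition[OF assms(1,2,4,5)],
          unfolded d, OF has_derivative_transition[OF assms(2,3,5,6)]])
  \<comment> \<open>The composite is known to agree with the direct coordinate change on the overlap
    of \<open>c\<close> and \<open>d\<close>, an open set around \<open>snd c p\<close>; this
    suffices for the derivative there.\<close>
  then have "((snd e \<circ> chart_inv c) has_derivative jacobian d e p \<circ> jacobian c d p) (at (snd c p))"
    by (rule has_derivative_transform_within_open[OF _ open_overlap[of c d]])
       (use assms in \<open>auto simp: chart_inv_chart\<close>)
  then have "jacobian d e p \<circ> jacobian c d p = jacobian c e p"
    using has_derivative_transition[of c e p] assms has_derivative_unique by blast
  then show ?thesis
    by (auto dest: fun_cong)
qed

lemma jacobian_refl:
  assumes "c \<in> A" "p \<in> fst c"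
  shows "jacobian c c p v = v"
proof -
  have "((\<lambda>x. x) has_derivative (\<lambda>v. v)) (at (snd c p))"
    by simp
  then have "((snd c \<circ> chart_inv c) has_derivative (\<lambda>v. v)) (at (snd c p))"
    by (rule has_derivative_transform_within_open[OF _ open_overlap[of c c]])
       (use assms in \<open>auto simp: chart_inv_chart\<close>)
  then have "(\<lambda>v. v) = jacobian c c p"
    using has_derivative_transition[of c c p] assms has_derivative_unique by blast
  then show ?thesis
    by (simp add: fun_eq_iff)
qed

lemma tangent_to_chart_jacobian: "tangent_to_chart A c p = jacobian (chart_at A p) c p"
  by (simp add: tangent_to_chart_def jacobian_def)

lemma tangent_of_chart_jacobian: "tangent_of_chart A c p = jacobian c (chart_at A p) p"
  by (simp add: tangent_of_chart_def jacobian_def)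

lemma linear_tangent_to_chart: "c \<in> A \<Longrightarrow> p \<in> fst c \<Longrightarrow> linear (tangent_to_chart A c p)"
  unfolding tangent_to_chart_jacobian by (intro linear_jacobian chart_at_props)

lemma linear_tangent_of_chart: "c \<in> A \<Longrightarrow> p \<in> fst c \<Longrightarrow> linear (tangent_of_chart A c p)"
  unfolding tangent_of_chart_jacobian by (intro linear_jacobian chart_at_props)

lemma tangent_to_of_chart:
  assumes "c \<in> A" "d \<in> A" "p \<in> fst c" "p \<in> fst d"
  shows "tangent_to_chart A d p (tangent_of_chart A c p v) = jacobian c d p v"
  unfolding tangent_to_chart_jacobian tangent_of_chart_jacobian
  using assms by (intro jacobian_chain chart_at_props)

lemma tangent_of_to_chart:
  assumes "c \<in> A" "p \<in> fst c"
  shows "tangent_of_chart A c p (tangent_to_chart A c p v) = v"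
  unfolding tangent_to_chart_jacobian tangent_of_chart_jacobian
  using assms by (simp add: jacobian_chain chart_at_props jacobian_refl)

section \<open>Smoothness near a point of the manifold\<close>

definition smooth_at :: "('a \<Rightarrow> 'v::real_normed_vector) \<Rightarrow> 'a \<Rightarrow> bool" where
  "smooth_at h p \<longleftrightarrow> (\<exists>c\<in>A. \<exists>U. open U \<and> p \<in> U \<and> U \<subseteq> fst c \<and> smooth_on (snd c ` U) (h \<circ> chart_inv c))"

text \<open>Smoothness in one chart is transported by the smooth coordinate change, on the part of
  the neighbourhood lying in both domains. This is why \<open>smooth_at\<close> may ask for a single
  chart.\<close>

lemma smooth_at_chart:
  assumes "smooth_at h p" "d \<in> A" "p \<in> fst d"
  obtains U where "open U" "p \<in> U" "U \<subseteq> fst d" "smooth_on (snd d ` U) (h \<circ> chart_inv d)"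
proof -
  obtain c U where U: "c \<in> A" "open U" "p \<in> U" "U \<subseteq> fst c" "smooth_on (snd c ` U) (h \<circ> chart_inv c)"
    using assms(1) unfolding smooth_at_def by blast
  let ?V = "U \<inter> fst d"
  have V: "open ?V" "p \<in> ?V" "?V \<subseteq> fst d"
    using U assms by (auto intro: open_chart_domain)
  have "smooth_on (snd d ` ?V) ((h \<circ> chart_inv c) \<circ> (snd c \<circ> chart_inv d))"
  proof (rule smooth_on_compose[where T = "snd c ` U"])
    show "open (snd d ` ?V)" "open (snd c ` U)"
      using open_chart_image_of V U assms by auto
    show "(snd c \<circ> chart_inv d) ` snd d ` ?V \<subseteq> snd c ` U"
      using assms(2) by (auto simp: chart_inv_chart)
    show "smooth_on (snd d ` ?V) (snd c \<circ> chart_inv d)"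
      by (rule smooth_on_subset[OF smooth_transition[OF assms(2) U(1)]]) (use U(4) in blast)
  qed (rule U)
  then have "smooth_on (snd d ` ?V) (h \<circ> chart_inv d)"
    by (rule smooth_on_cong[OF open_chart_image_of[OF assms(2) V(1,3)], rotated])
       (use assms(2) U in \<open>auto simp: chart_inv_chart subset_iff\<close>)
  then show thesis
    using that V by blast
qed

lemma smooth_atI:
  "c \<in> A \<Longrightarrow> open U \<Longrightarrow> p \<in> U \<Longrightarrow> U \<subseteq> fst c \<Longrightarrow> smooth_on (snd c ` U) (h \<circ> chart_inv c) \<Longrightarrow> smooth_at h p"
  unfolding smooth_at_def by blast

lemma smooth_at_imp_smooth_on:
  assumes "c \<in> A" "U \<subseteq> fst c" "\<And>p. p \<in> U \<Longrightarrow> smooth_at h p"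
  shows "smooth_on (snd c ` U) (h \<circ> chart_inv c)"
proof (rule smooth_on_locally)
  fix x assume "x \<in> snd c ` U"
  then obtain p where p: "p \<in> U" "x = snd c p" by blast
  have "p \<in> fst c" using p assms(2) by blast
  with assms(3)[OF p(1)] assms(1) obtain V
    where "open V" "p \<in> V" "V \<subseteq> fst c" "smooth_on (snd c ` V) (h \<circ> chart_inv c)"
    by (rule smooth_at_chart)
  then show "\<exists>U. open U \<and> x \<in> U \<and> smooth_on U (h \<circ> chart_inv c)"
    using open_chart_image_of[OF assms(1)] p by blast
qed

lemma smooth_on_chart_iff:
  assumes "c \<in> A"
  shows "smooth_on (chart_image c) (h \<circ> chart_inv c) \<longleftrightarrow> (\<forall>p\<in>fst c. smooth_at h p)"
  using smooth_atI[OF assms open_chart_domain[OF assms], of _ h] smooth_at_imp_smooth_on[OF assms, of "fst c" h]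
  unfolding chart_image_def by blast

lemma smooth_at_cong:
  assumes "smooth_at f p" "open V" "p \<in> V" "\<And>q. q \<in> V \<Longrightarrow> f q = g q"
  shows "smooth_at g p"
proof -
  obtain c U where U: "c \<in> A" "open U" "p \<in> U" "U \<subseteq> fst c" "smooth_on (snd c ` U) (f \<circ> chart_inv c)"
    using assms(1) unfolding smooth_at_def by blast
  have "smooth_on (snd c ` (U \<inter> V)) (f \<circ> chart_inv c)"
    by (rule smooth_on_subset[OF U(5)]) blast
  then have "smooth_on (snd c ` (U \<inter> V)) (g \<circ> chart_inv c)"
    by (rule smooth_on_cong[OF open_chart_image_of, rotated -1])
       (use U assms in \<open>auto simp: chart_inv_chart subset_iff\<close>)
  then show ?thesis
    using U assms by (intro smooth_atI[of c "U \<inter> V"]) auto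
qed

text \<open>Transfers an operation that preserves every finite order on open sets of the model space
  to the manifold; both functions are viewed in one chart on the intersection of their
  neighbourhoods.\<close>

lemma smooth_at_combine:
  assumes "smooth_at f p" "smooth_at g p"
    and "\<And>(S::'e set) k F G. open S \<Longrightarrow> Ck_on k S F \<Longrightarrow> Ck_on k S G \<Longrightarrow> Ck_on k S (\<lambda>x. b (F x) (G x))"
  shows "smooth_at (\<lambda>q. b (f q) (g q)) p"
proof -
  let ?c = "chart_at A p"
  obtain U where U: "open U" "p \<in> U" "U \<subseteq> fst ?c" "smooth_on (snd ?c ` U) (f \<circ> chart_inv ?c)"
    using smooth_at_chart[OF assms(1) chart_at_props] .
  obtain V where V: "open V" "p \<in> V" "V \<subseteq> fst ?c" "smooth_on (snd ?c ` V) (g \<circ> chart_inv ?c)"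
    using smooth_at_chart[OF assms(2) chart_at_props] .
  have "open (snd ?c ` (U \<inter> V))"
    using U V by (intro open_chart_image_of chart_at_props) auto
  moreover have "smooth_on (snd ?c ` (U \<inter> V)) (f \<circ> chart_inv ?c)" "smooth_on (snd ?c ` (U \<inter> V)) (g \<circ> chart_inv ?c)"
    by (rule smooth_on_subset[OF U(4)], blast, rule smooth_on_subset[OF V(4)], blast)
  ultimately have "Ck_on k (snd ?c ` (U \<inter> V)) (\<lambda>x. b ((f \<circ> chart_inv ?c) x) ((g \<circ> chart_inv ?c) x))" for k
    unfolding smooth_on_def by (intro assms(3)) (auto simp: comp_def)
  then have "smooth_on (snd ?c ` (U \<inter> V)) ((\<lambda>q. b (f q) (g q)) \<circ> chart_inv ?c)"
    by (simp add: smooth_on_def comp_def)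
  then show ?thesis
    using U V by (intro smooth_atI[of ?c "U \<inter> V"] chart_at_props) auto
qed

lemma smooth_at_const: "smooth_at (\<lambda>q. v) p"
  using open_chart_image_of[OF chart_at_props(1) open_chart_domain[OF chart_at_props(1)], of p p]
  by (intro smooth_atI[OF chart_at_props(1) open_chart_domain[OF chart_at_props(1)] chart_at_props(2)])
     (auto simp: smooth_on_def comp_def intro: Ck_on_const)

lemma smooth_at_add: "smooth_at f p \<Longrightarrow> smooth_at g p \<Longrightarrow> smooth_at (\<lambda>q. f q + g q) p"
  by (rule smooth_at_combine) (auto intro: Ck_on_add)

lemma smooth_at_scaleR: "smooth_at f p \<Longrightarrow> smooth_at g p \<Longrightarrow> smooth_at (\<lambda>q. f q *\<^sub>R g q) p"
  by (rule smooth_at_combine) (auto intro: Ck_on_scaleR)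

lemma smooth_at_mult:
  fixes f g :: "'a \<Rightarrow> real"
  shows "smooth_at f p \<Longrightarrow> smooth_at g p \<Longrightarrow> smooth_at (\<lambda>q. f q * g q) p"
  using smooth_at_scaleR[of f p g] by simp

lemma smooth_at_bounded_linear:
  assumes "bounded_linear L" "smooth_at f p"
  shows "smooth_at (\<lambda>q. L (f q)) p"
  using smooth_at_combine[OF assms(2,2), where b = "\<lambda>x y. L x"] Ck_on_bounded_linear_compose[OF assms(1)]
  by blast

lemma smooth_at_sum:
  "(\<And>i. i \<in> I \<Longrightarrow> smooth_at (f i) p) \<Longrightarrow> smooth_at (\<lambda>q. \<Sum>i\<in>I. f i q) p"
  by (induction I rule: infinite_finite_induct) (auto intro: smooth_at_const smooth_at_add)

text \<open>\<open>f\<close> is continuous in the chart, so it stays nonzero near \<open>p\<close>.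
  The neighbourhood is part of the conclusion because \<open>smooth_at_cancel\<close> has to compare
  functions on it.\<close>

lemma smooth_at_inverse:
  fixes f :: "'a \<Rightarrow> real"
  assumes "smooth_at f p" "f p \<noteq> 0"
  obtains V where "open V" "p \<in> V" "\<And>q. q \<in> V \<Longrightarrow> f q \<noteq> 0" "smooth_at (\<lambda>q. inverse (f q)) p"
proof -
  obtain c U where U: "c \<in> A" "open U" "p \<in> U" "U \<subseteq> fst c" "smooth_on (snd c ` U) (f \<circ> chart_inv c)"
    using assms(1) unfolding smooth_at_def by blast
  have "continuous_on (snd c ` U) (f \<circ> chart_inv c)"
    using U(5) Ck_on.simps(1) unfolding smooth_on_def by blast
  then have W: "open (snd c ` U \<inter> (f \<circ> chart_inv c) -` (- {0}))" (is "open ?W")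
    by (intro continuous_open_preimage open_chart_image_of U) auto
  let ?V = "fst c \<inter> snd c -` ?W"
  have inv: "chart_inv c (snd c q) = q" if "q \<in> fst c" for q
    using chart_inv_chart[OF U(1) that] .
  have V: "open ?V"
    using open_chart_preimage[OF U(1) W] .
  have p: "p \<in> ?V"
    using U assms(2) inv[of p] by auto
  have "smooth_on (snd c ` ?V) (f \<circ> chart_inv c)"
    by (rule smooth_on_subset[OF U(5)]) blast
  moreover have "open (snd c ` ?V)"
    by (rule open_chart_image_of[OF U(1) V]) blast
  ultimately have "smooth_on (snd c ` ?V) ((\<lambda>q. inverse (f q)) \<circ> chart_inv c)"
    unfolding smooth_on_def comp_def by (auto intro: Ck_on_inverse)
  then have "smooth_at (\<lambda>q. inverse (f q)) p"
    using U(1) V p by (intro smooth_atI[of c ?V]) auto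
  moreover have "f q \<noteq> 0" if "q \<in> ?V" for q
    using that inv[of q] by auto
  ultimately show thesis
    using that V p by blast
qed

lemma smooth_at_solution:
  fixes L :: "'a \<Rightarrow> 'f::euclidean_space \<Rightarrow> 'f"
  assumes "open U" "p \<in> U"
    and "\<And>q. q \<in> U \<Longrightarrow> linear (L q)" "\<And>q. q \<in> U \<Longrightarrow> inj (L q)"
    and "\<And>q v. q \<in> U \<Longrightarrow> smooth_at (\<lambda>q. L q v) q" "\<And>q. q \<in> U \<Longrightarrow> smooth_at \<xi> q"
    and "\<And>q. q \<in> U \<Longrightarrow> L q (X q) = \<xi> q"
  shows "smooth_at X p"
proof -
  define c where "c = chart_at A p"
  have c: "c \<in> A" "p \<in> fst c" unfolding c_def by (rule chart_at_props)+
  let ?V = "U \<inter> fst c"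
  have S: "open (snd c ` ?V)"
    using c assms(1) by (intro open_chart_image_of) (auto intro: open_chart_domain)
  have inv: "chart_inv c x \<in> U" if "x \<in> snd c ` ?V" for x
    using that c by (auto simp: chart_inv_chart)
  have "smooth_on (snd c ` ?V) ((\<lambda>q. L q v) \<circ> chart_inv c)" for v
    using c assms(5) by (intro smooth_at_imp_smooth_on) auto
  then have L: "Ck_on k (snd c ` ?V) (\<lambda>x. L (chart_inv c x) v)" for k v
    by (simp add: smooth_on_def comp_def)
  have "smooth_on (snd c ` ?V) (\<xi> \<circ> chart_inv c)"
    using c assms(6) by (intro smooth_at_imp_smooth_on) auto
  then have \<xi>: "Ck_on k (snd c ` ?V) (\<xi> \<circ> chart_inv c)" for k
    by (simp add: smooth_on_def)
  have "Ck_on k (snd c ` ?V) (X \<circ> chart_inv c)" for k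
  proof (rule Ck_on_solution[where L = "\<lambda>x. L (chart_inv c x)", OF S _ _ L \<xi>])
    fix x assume "x \<in> snd c ` ?V"
    then have "chart_inv c x \<in> U" by (rule inv)
    then show "linear (L (chart_inv c x))" "inj (L (chart_inv c x))"
      "L (chart_inv c x) ((X \<circ> chart_inv c) x) = (\<xi> \<circ> chart_inv c) x"
      using assms(3,4,7) by simp_all
  qed
  then show ?thesis
    using c assms(1,2)
    by (intro smooth_atI[of c ?V]) (auto simp: smooth_on_def intro: open_chart_domain)
qed

section \<open>Smooth functions, vector fields and one-forms tested point by point\<close>

lemma smooth_functions_iff: "f \<in> smooth_functions A \<longleftrightarrow> (\<forall>p. smooth_at f p)"
  unfolding smooth_functions_def using smooth_on_chart_iff chart_at_props by blast

lemma vector_fields_iff: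
  "X \<in> vector_fields A \<longleftrightarrow> (\<forall>c\<in>A. \<forall>p\<in>fst c. smooth_at (\<lambda>q. tangent_to_chart A c q (X q)) p)"
  unfolding vector_fields_def using smooth_on_chart_iff by blast

lemma one_forms_iff:
  "\<xi> \<in> one_forms A \<longleftrightarrow>
     (\<forall>c\<in>A. \<forall>p\<in>fst c. \<forall>v. smooth_at (\<lambda>q. blinfun_apply (\<xi> q) (tangent_of_chart A c q v)) p)"
  unfolding one_forms_def using smooth_on_chart_iff by blast

lemma smooth_at_jacobian:
  assumes "c \<in> A" "d \<in> A" "p \<in> fst c" "p \<in> fst d"
  shows "smooth_at (\<lambda>q. jacobian c d q v) p"
proof (rule smooth_atI[OF assms(1)])
  show "open (fst c \<inter> fst d)" using assms by (auto intro: open_chart_domain)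
  have "smooth_on (snd c ` (fst c \<inter> fst d)) (\<lambda>x. frechet_derivative (snd d \<circ> chart_inv c) (at x) v)"
    by (rule smooth_on_frechet_derivative[OF smooth_transition[OF assms(1,2)]])
  then show "smooth_on (snd c ` (fst c \<inter> fst d)) ((\<lambda>q. jacobian c d q v) \<circ> chart_inv c)"
    by (rule smooth_on_cong[OF open_overlap[OF assms(1,2)], rotated])
       (use assms in \<open>auto simp: jacobian_def chart_inv_chart\<close>)
qed (use assms in auto)

text \<open>The components in \<open>d\<close> are the components in \<open>c\<close> multiplied by
  the columns of the Jacobian, all of them smooth. So a field has to be examined in one chart around
  each point, although \<open>vector_fields\<close> mentions all charts.\<close>

lemma smooth_at_change_chart:
  assumes "c \<in> A" "d \<in> A" "p \<in> fst c" "p \<in> fst d"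
    and "smooth_at (\<lambda>q. tangent_to_chart A c q (X q)) p"
  shows "smooth_at (\<lambda>q. tangent_to_chart A d q (X q)) p"
proof (rule smooth_at_cong)
  show "smooth_at (\<lambda>q. \<Sum>b\<in>Basis. (tangent_to_chart A c q (X q) \<bullet> b) *\<^sub>R jacobian c d q b) p"
    using assms
    by (intro smooth_at_sum smooth_at_scaleR smooth_at_jacobian
        smooth_at_bounded_linear[OF bounded_linear_inner_left])
  show "open (fst c \<inter> fst d)" using assms by (auto intro: open_chart_domain)
  show "(\<Sum>b\<in>Basis. (tangent_to_chart A c q (X q) \<bullet> b) *\<^sub>R jacobian c d q b) = tangent_to_chart A d q (X q)"
    if "q \<in> fst c \<inter> fst d" for q
    using linear_eq_sum_Basis[OF linear_jacobian[of c d q], of "tangent_to_chart A c q (X q)"]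
      tangent_to_of_chart[of c d q "tangent_to_chart A c q (X q)"] tangent_of_to_chart[of c q "X q"]
      that assms by simp
qed (use assms in auto)

section \<open>Cut-off functions and local frames\<close>

lemma manifold_bump_function:
  assumes "c \<in> A" "p \<in> fst c"
  obtains f K where "f \<in> smooth_functions A" "f p \<noteq> 0" "closed K" "K \<subseteq> fst c" "\<And>q. q \<notin> K \<Longrightarrow> f q = 0"
proof -
  have "snd c p \<in> chart_image c"
    using assms(2) by (simp add: chart_image_def)
  then obtain r where r: "r > 0" "cball (snd c p) r \<subseteq> chart_image c"
    using open_chart_image[OF assms(1)] open_contains_cball by blast
  obtain F :: "'e \<Rightarrow> real" where F: "smooth_on UNIV F" "F (snd c p) \<noteq> 0" "\<And>y. y \<notin> cball (snd c p) r \<Longrightarrow> F y = 0"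
    using bump_function[OF r(1)] by blast
  let ?K = "chart_inv c ` cball (snd c p) r"
  let ?f = "\<lambda>q. if q \<in> fst c then F (snd c q) else 0"
  have "continuous_on (cball (snd c p) r) (chart_inv c)"
    by (rule continuous_on_subset[OF homeomorphism_cont2[OF chart_homeomorphism[OF assms(1)]] r(2)])
  \<comment> \<open>Compact, hence closed because the manifold is Hausdorff. This makes
    \<open>- ?K\<close> an open set on which \<open>?f\<close> vanishes and which contains every
    point outside the chart domain, so the extension by zero is smooth there.\<close>
  then have K: "closed ?K"
    by (intro compact_imp_closed compact_continuous_image) auto
  have Kc: "?K \<subseteq> fst c"
    using homeomorphism_image2[OF chart_homeomorphism[OF assms(1)]] r(2) by blast
  have f0: "?f q = 0" if "q \<notin> ?K" for q
    using that F(3)[of "snd c q"] chart_inv_chart[OF assms(1), of q] by force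
  have "smooth_at ?f q" for q
  proof (cases "q \<in> fst c")
    case True
    have "smooth_on (snd c ` fst c) F"
      by (rule smooth_on_subset[OF F(1)]) simp
    then have "smooth_on (snd c ` fst c) (?f \<circ> chart_inv c)"
      by (rule smooth_on_cong[OF open_chart_image_of[OF assms(1) open_chart_domain[OF assms(1)] subset_refl], rotated])
         (auto simp: chart_inv_chart assms(1))
    then show ?thesis
      using True by (intro smooth_atI[OF assms(1) open_chart_domain[OF assms(1)]]) auto
  next
    case False
    then show ?thesis
      using K Kc f0 by (intro smooth_at_cong[OF smooth_at_const[of 0], of "- ?K"]) auto
  qed
  then have "?f \<in> smooth_functions A"
    by (simp add: smooth_functions_iff)
  moreover have "?f p \<noteq> 0" using F(2) assms(2) by simp
  ultimately show thesis
    using that K Kc f0 by blast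
qed

lemma vector_field_cutoff:
  assumes "c \<in> A" "f \<in> smooth_functions A" "closed K" "K \<subseteq> fst c" "\<And>q. q \<notin> K \<Longrightarrow> f q = 0"
    and "\<And>q. q \<in> fst c \<Longrightarrow> smooth_at (\<lambda>q. tangent_to_chart A c q (Y q)) q"
  shows "(\<lambda>q. f q *\<^sub>R Y q) \<in> vector_fields A"
  unfolding vector_fields_iff
proof (intro ballI)
  fix d p assume d: "d \<in> A" "p \<in> fst d"
  show "smooth_at (\<lambda>q. tangent_to_chart A d q (f q *\<^sub>R Y q)) p"
  proof (cases "p \<in> fst c")
    case True
    have "smooth_at (\<lambda>q. f q *\<^sub>R tangent_to_chart A d q (Y q)) p"
      using assms True d
      by (intro smooth_at_scaleR smooth_at_change_chart[of c d p]) (auto simp: smooth_functions_iff)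
    then show ?thesis
      by (rule smooth_at_cong[OF _ open_chart_domain[OF d(1)] d(2)])
         (simp add: linear_scale[OF linear_tangent_to_chart[OF d(1)]])
  next
    case False
    then show ?thesis
      using assms(3,4) d open_chart_domain[OF d(1)]
      by (intro smooth_at_cong[OF smooth_at_const[of 0], of "fst d \<inter> - K"])
         (auto simp: assms(5) linear_0[OF linear_tangent_to_chart[OF d(1)]])
  qed
qed

lemma smooth_function_cutoff:
  assumes "f \<in> smooth_functions A" "closed K" "K \<subseteq> fst c" "\<And>q. q \<notin> K \<Longrightarrow> f q = 0"
    and "\<And>q. q \<in> fst c \<Longrightarrow> smooth_at h q"
  shows "(\<lambda>q. f q * h q) \<in> smooth_functions A"
  unfolding smooth_functions_iff
proof
  fix p
  show "smooth_at (\<lambda>q. f q * h q) p"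
  proof (cases "p \<in> fst c")
    case True
    then show ?thesis
      using assms by (intro smooth_at_mult) (auto simp: smooth_functions_iff)
  next
    case False
    then show ?thesis
      using assms(2,3) by (intro smooth_at_cong[OF smooth_at_const[of 0], of "- K"]) (auto simp: assms(4))
  qed
qed

lemma smooth_at_coordinate_field:
  assumes "c \<in> A" "p \<in> fst c"
  shows "smooth_at (\<lambda>q. tangent_to_chart A c q (tangent_of_chart A c q v)) p"
  by (rule smooth_at_cong[OF smooth_at_const[of v] open_chart_domain[OF assms(1)] assms(2)])
     (simp add: assms tangent_to_of_chart jacobian_refl)

text \<open>A single cut-off \<open>f\<close> turns all coordinate fields of \<open>c\<close> and
  all functions smooth on its domain into global objects. As \<open>f p \<noteq> 0\<close>, nothing
  is lost near \<open>p\<close>: \<open>f\<close> can be divided out again.\<close>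

lemma local_frame:
  assumes "c \<in> A" "p \<in> fst c"
  obtains f where "f \<in> smooth_functions A" "f p \<noteq> 0"
    "\<And>v. (\<lambda>q. f q *\<^sub>R tangent_of_chart A c q v) \<in> vector_fields A"
    "\<And>h. (\<And>q. q \<in> fst c \<Longrightarrow> smooth_at h q) \<Longrightarrow> (\<lambda>q. f q * h q) \<in> smooth_functions A"
    "\<And>q. q \<notin> fst c \<Longrightarrow> f q = 0"
proof -
  obtain f K where f: "f \<in> smooth_functions A" "f p \<noteq> 0" "closed K" "K \<subseteq> fst c" "\<And>q. q \<notin> K \<Longrightarrow> f q = 0"
    using manifold_bump_function[OF assms] by blast
  show thesis
  proof (rule that[OF f(1,2)])
    show "(\<lambda>q. f q *\<^sub>R tangent_of_chart A c q v) \<in> vector_fields A" for v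
      using assms(1) f by (intro vector_field_cutoff[of c f K] smooth_at_coordinate_field) auto
    show "(\<lambda>q. f q * h q) \<in> smooth_functions A" if "\<And>q. q \<in> fst c \<Longrightarrow> smooth_at h q" for h
      using f that by (intro smooth_function_cutoff[of f K c]) auto
    show "f q = 0" if "q \<notin> fst c" for q
      using f that by blast
  qed
qed

section \<open>Module operations on vector fields and one-forms\<close>

lemma const_smooth_function: "(\<lambda>q. k) \<in> smooth_functions A"
  by (simp add: smooth_functions_iff smooth_at_const)

lemma smooth_functions_mult:
  "f \<in> smooth_functions A \<Longrightarrow> h \<in> smooth_functions A \<Longrightarrow> (\<lambda>q. f q * h q) \<in> smooth_functions A"
  by (simp add: smooth_functions_iff smooth_at_mult)

lemma vector_fields_add:
  assumes "X \<in> vector_fields A" "Y \<in> vector_fields A"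
  shows "(\<lambda>q. X q + Y q) \<in> vector_fields A"
  unfolding vector_fields_iff
proof (intro ballI)
  fix c p assume c: "c \<in> A" "p \<in> fst c"
  have "smooth_at (\<lambda>q. tangent_to_chart A c q (X q) + tangent_to_chart A c q (Y q)) p"
    using assms c by (intro smooth_at_add) (auto simp: vector_fields_iff)
  then show "smooth_at (\<lambda>q. tangent_to_chart A c q (X q + Y q)) p"
    by (rule smooth_at_cong[OF _ open_chart_domain[OF c(1)] c(2)])
       (simp add: linear_add[OF linear_tangent_to_chart[OF c(1)]])
qed

lemma vector_fields_scale:
  assumes "f \<in> smooth_functions A" "X \<in> vector_fields A"
  shows "(\<lambda>q. f q *\<^sub>R X q) \<in> vector_fields A"
  unfolding vector_fields_iff
proof (intro ballI)
  fix c p assume c: "c \<in> A" "p \<in> fst c"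
  have "smooth_at (\<lambda>q. f q *\<^sub>R tangent_to_chart A c q (X q)) p"
    using assms c by (intro smooth_at_scaleR) (auto simp: vector_fields_iff smooth_functions_iff)
  then show "smooth_at (\<lambda>q. tangent_to_chart A c q (f q *\<^sub>R X q)) p"
    by (rule smooth_at_cong[OF _ open_chart_domain[OF c(1)] c(2)])
       (simp add: linear_scale[OF linear_tangent_to_chart[OF c(1)]])
qed

lemma vector_fields_const_scale: "X \<in> vector_fields A \<Longrightarrow> (\<lambda>q. k *\<^sub>R X q) \<in> vector_fields A"
  using vector_fields_scale[OF const_smooth_function] .

lemma vector_fields_uminus: "X \<in> vector_fields A \<Longrightarrow> (\<lambda>q. - X q) \<in> vector_fields A"
  using vector_fields_const_scale[of X "-1"] by simp

lemma vector_fields_diff: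
  "X \<in> vector_fields A \<Longrightarrow> Y \<in> vector_fields A \<Longrightarrow> (\<lambda>q. X q - Y q) \<in> vector_fields A"
  using vector_fields_add[OF _ vector_fields_uminus] by fastforce

lemma vector_fields_zero: "(\<lambda>q. 0) \<in> vector_fields A"
  unfolding vector_fields_iff
  by (intro ballI smooth_at_cong[OF smooth_at_const[of 0] open_chart_domain])
     (auto simp: linear_0[OF linear_tangent_to_chart])

lemma vector_fields_sum:
  "(\<And>i. i \<in> I \<Longrightarrow> X i \<in> vector_fields A) \<Longrightarrow> (\<lambda>q. \<Sum>i\<in>I. X i q) \<in> vector_fields A"
  by (induction I rule: infinite_finite_induct) (auto intro: vector_fields_zero vector_fields_add)

lemma one_forms_scale:
  assumes "f \<in> smooth_functions A" "\<xi> \<in> one_forms A"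
  shows "(\<lambda>q. f q *\<^sub>R \<xi> q) \<in> one_forms A"
  using assms unfolding one_forms_iff smooth_functions_iff
  by (auto simp: blinfun.scaleR_left intro: smooth_at_mult)

lemma one_forms_zero: "(\<lambda>q. 0) \<in> one_forms A"
  unfolding one_forms_iff by (simp add: smooth_at_const)

lemma one_forms_uminus: "\<xi> \<in> one_forms A \<Longrightarrow> (\<lambda>q. - \<xi> q) \<in> one_forms A"
  using one_forms_scale[OF const_smooth_function[of "-1"]] by fastforce

text \<open>In the chart \<open>chart_at A p\<close> the components at \<open>p\<close> are the
  vector itself. The coordinate field of \<open>v\<close>, cut off and rescaled by
  \<open>inverse (f p)\<close>, therefore takes the value \<open>v\<close> there.\<close>

lemma vector_field_through:
  obtains X where "X \<in> vector_fields A" "X p = v"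
proof -
  let ?c = "chart_at A p"
  obtain f where f: "f p \<noteq> 0" "\<And>v. (\<lambda>q. f q *\<^sub>R tangent_of_chart A ?c q v) \<in> vector_fields A"
    by (rule local_frame[OF chart_at_props[of p]]) (rule that)
  show thesis
  proof (rule that)
    show "(\<lambda>q. f q *\<^sub>R tangent_of_chart A ?c q (inverse (f p) *\<^sub>R v)) \<in> vector_fields A"
      by (rule f)
    show "f p *\<^sub>R tangent_of_chart A ?c p (inverse (f p) *\<^sub>R v) = v"
      using f(1) chart_at_props
      by (simp add: linear_scale[OF linear_tangent_of_chart] tangent_of_chart_jacobian jacobian_refl)
  qed
qed

end

section \<open>Tensors\<close>

context smooth_manifold
begin

lemma smooth_at_cancel:
  fixes f h :: "'a \<Rightarrow> real"
  assumes "smooth_at f p" "f p \<noteq> 0" "smooth_at (\<lambda>q. f q * h q) p"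
  shows "smooth_at h p"
proof -
  obtain V where V: "open V" "p \<in> V" "\<And>q. q \<in> V \<Longrightarrow> f q \<noteq> 0" "smooth_at (\<lambda>q. inverse (f q)) p"
    using smooth_at_inverse[OF assms(1,2)] by blast
  show ?thesis
    by (rule smooth_at_cong[OF smooth_at_mult[OF V(4) assms(3)] V(1,2)]) (use V(3) in simp)
qed

section \<open>Functionals linear over the smooth functions\<close>

definition functional :: "(('a \<Rightarrow> 'e) \<Rightarrow> 'a \<Rightarrow> real) \<Rightarrow> bool" where
  "functional \<omega> \<longleftrightarrow>
     (\<forall>X\<in>vector_fields A. \<omega> X \<in> smooth_functions A) \<and>
     (\<forall>X\<in>vector_fields A. \<forall>Y\<in>vector_fields A. \<omega> (\<lambda>p. X p + Y p) = (\<lambda>p. \<omega> X p + \<omega> Y p)) \<and>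
     (\<forall>f\<in>smooth_functions A. \<forall>X\<in>vector_fields A. \<omega> (\<lambda>p. f p *\<^sub>R X p) = (\<lambda>p. f p * \<omega> X p))"

lemma functional_smooth: "functional \<omega> \<Longrightarrow> X \<in> vector_fields A \<Longrightarrow> smooth_at (\<omega> X) p"
  unfolding functional_def smooth_functions_iff by blast

lemma functional_add:
  "functional \<omega> \<Longrightarrow> X \<in> vector_fields A \<Longrightarrow> Y \<in> vector_fields A \<Longrightarrow> \<omega> (\<lambda>p. X p + Y p) = (\<lambda>p. \<omega> X p + \<omega> Y p)"
  unfolding functional_def by blast

lemma functional_scale:
  "functional \<omega> \<Longrightarrow> f \<in> smooth_functions A \<Longrightarrow> X \<in> vector_fields A \<Longrightarrow> \<omega> (\<lambda>p. f p *\<^sub>R X p) = (\<lambda>p. f p * \<omega> X p)"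
  unfolding functional_def by blast

lemma functional_const_scale:
  "functional \<omega> \<Longrightarrow> X \<in> vector_fields A \<Longrightarrow> \<omega> (\<lambda>p. k *\<^sub>R X p) = (\<lambda>p. k * \<omega> X p)"
  using functional_scale[OF _ const_smooth_function] .

lemma functional_zero: "functional \<omega> \<Longrightarrow> \<omega> (\<lambda>p. 0) = (\<lambda>p. 0)"
  using functional_const_scale[OF _ vector_fields_zero, of \<omega> 0] by simp

lemma functional_sum:
  assumes "functional \<omega>" "\<And>i. i \<in> I \<Longrightarrow> X i \<in> vector_fields A"
  shows "\<omega> (\<lambda>p. \<Sum>i\<in>I. X i p) = (\<lambda>p. \<Sum>i\<in>I. \<omega> (X i) p)"
  using assms(2)
proof (induction I rule: infinite_finite_induct)
  case (insert i I)
  then show ?case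
    using functional_add[OF assms(1), of "X i" "\<lambda>p. \<Sum>i\<in>I. X i p"] vector_fields_sum[of I X] by simp
qed (simp_all add: functional_zero[OF assms(1)])

text \<open>
  For a bump function \<open>f\<close> supported in a chart with coordinate fields \<open>E\<^sub>b\<close>, the identity
  \<open>f\<^sup>2 X = \<Sum>\<^sub>b (f X\<^sup>b) (f E\<^sub>b)\<close> has globally defined smooth factors, so linearity over the
  smooth functions applies to it.
\<close>

lemma functional_zero_at:
  assumes "functional \<omega>" "X \<in> vector_fields A" "X p = 0"
  shows "\<omega> X p = 0"
proof -
  define c where "c = chart_at A p"
  have c: "c \<in> A" "p \<in> fst c" unfolding c_def by (rule chart_at_props)+
  obtain f where f: "f \<in> smooth_functions A" "f p \<noteq> 0"
    "\<And>v. (\<lambda>q. f q *\<^sub>R tangent_of_chart A c q v) \<in> vector_fields A"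
    "\<And>h. (\<And>q. q \<in> fst c \<Longrightarrow> smooth_at h q) \<Longrightarrow> (\<lambda>q. f q * h q) \<in> smooth_functions A"
    "\<And>q. q \<notin> fst c \<Longrightarrow> f q = 0"
    by (rule local_frame[OF c]) (rule that, assumption+, blast+)
  let ?h = "\<lambda>b q. tangent_to_chart A c q (X q) \<bullet> b"
  have h: "(\<lambda>q. f q * ?h b q) \<in> smooth_functions A" for b
    using assms(2) c
    by (intro f(4) smooth_at_bounded_linear[OF bounded_linear_inner_left]) (auto simp: vector_fields_iff)
  have "(f q * f q) *\<^sub>R X q = (\<Sum>b\<in>Basis. (f q * ?h b q) *\<^sub>R (f q *\<^sub>R tangent_of_chart A c q b))" for q
  proof (cases "q \<in> fst c")
    case True
    have "X q = (\<Sum>b\<in>Basis. ?h b q *\<^sub>R tangent_of_chart A c q b)"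
      using linear_eq_sum_Basis[OF linear_tangent_of_chart[OF c(1) True]] tangent_of_to_chart[OF c(1) True] by metis
    then have "(f q * f q) *\<^sub>R X q = (f q * f q) *\<^sub>R (\<Sum>b\<in>Basis. ?h b q *\<^sub>R tangent_of_chart A c q b)"
      by (rule arg_cong)
    then show ?thesis
      by (simp add: scaleR_sum_right mult_ac)
  qed (simp add: f(5))
  then have "\<omega> (\<lambda>q. (f q * f q) *\<^sub>R X q)
    = \<omega> (\<lambda>q. \<Sum>b\<in>Basis. (f q * ?h b q) *\<^sub>R (f q *\<^sub>R tangent_of_chart A c q b))"
    by presburger
  also have "\<dots> = (\<lambda>q. \<Sum>b\<in>Basis. \<omega> (\<lambda>q. (f q * ?h b q) *\<^sub>R (f q *\<^sub>R tangent_of_chart A c q b)) q)"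
    by (rule functional_sum[OF assms(1) vector_fields_scale[OF h f(3)]])
  also have "\<dots> = (\<lambda>q. \<Sum>b\<in>Basis. (f q * ?h b q) * \<omega> (\<lambda>q. f q *\<^sub>R tangent_of_chart A c q b) q)"
    by (simp only: functional_scale[OF assms(1) h f(3)])
  finally have "f p * f p * \<omega> X p = (\<Sum>b\<in>Basis. (f p * ?h b p) * \<omega> (\<lambda>q. f q *\<^sub>R tangent_of_chart A c q b) p)"
    using functional_scale[OF assms(1) smooth_functions_mult[OF f(1,1)] assms(2)] by (auto dest: fun_cong)
  also have "\<dots> = 0"
    using assms(3) c by (simp add: linear_0[OF linear_tangent_to_chart])
  finally show ?thesis
    using f(2) by simp
qed

lemma functional_pointwise:
  assumes "functional \<omega>" "X \<in> vector_fields A" "Y \<in> vector_fields A" "X p = Y p"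
  shows "\<omega> X p = \<omega> Y p"
proof -
  have Z: "(\<lambda>q. X q - Y q) \<in> vector_fields A"
    using assms by (intro vector_fields_diff)
  have "\<omega> (\<lambda>q. Y q + (X q - Y q)) p = \<omega> Y p + \<omega> (\<lambda>q. X q - Y q) p"
    by (simp only: functional_add[OF assms(1,3) Z])
  then show ?thesis
    using functional_zero_at[OF assms(1) Z] assms(4) by simp
qed

text \<open>Evaluates a functional on a single tangent vector. Which extension is chosen does not
  matter, by \<open>functional_pointwise\<close>; it need not vary smoothly with
  \<open>p\<close>.\<close>

definition field_at :: "'a \<Rightarrow> 'e \<Rightarrow> 'a \<Rightarrow> 'e" where
  "field_at p v = (SOME X. X \<in> vector_fields A \<and> X p = v)"

lemma field_at: "field_at p v \<in> vector_fields A" "field_at p v p = v"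
proof -
  have "\<exists>X. X \<in> vector_fields A \<and> X p = v"
    using vector_field_through by metis
  then have "field_at p v \<in> vector_fields A \<and> field_at p v p = v"
    unfolding field_at_def by (rule someI_ex)
  then show "field_at p v \<in> vector_fields A" "field_at p v p = v" by auto
qed

lemma linear_functional_at:
  assumes "functional \<omega>"
  shows "linear (\<lambda>v. \<omega> (field_at p v) p)"
proof (rule linearI)
  fix u v k
  have "\<omega> (field_at p (u + v)) p = \<omega> (\<lambda>q. field_at p u q + field_at p v q) p"
    by (intro functional_pointwise[OF assms] vector_fields_add field_at) (simp add: field_at)
  then show "\<omega> (field_at p (u + v)) p = \<omega> (field_at p u) p + \<omega> (field_at p v) p"
    by (simp add: functional_add[OF assms field_at(1) field_at(1)])
  have "\<omega> (field_at p (k *\<^sub>R v)) p = \<omega> (\<lambda>q. k *\<^sub>R field_at p v q) p"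
    by (intro functional_pointwise[OF assms] vector_fields_const_scale field_at) (simp add: field_at)
  then show "\<omega> (field_at p (k *\<^sub>R v)) p = k *\<^sub>R \<omega> (field_at p v) p"
    by (simp add: functional_const_scale[OF assms field_at(1)])
qed

text \<open>The one-form is defined fibre by fibre through \<open>field_at\<close>, which says
  nothing about smoothness. This is read off instead from the values of \<open>\<omega>\<close> on
  cut-off coordinate fields, where the cut-off cancels near \<open>p\<close>.\<close>

lemma functional_one_form:
  assumes "functional \<omega>"
  shows "\<exists>\<xi>\<in>one_forms A. \<forall>Y\<in>vector_fields A. pairing \<xi> Y = \<omega> Y"
proof
  define \<xi> where "\<xi> p = Blinfun (\<lambda>v. \<omega> (field_at p v) p)" for p
  have \<xi>: "blinfun_apply (\<xi> p) v = \<omega> (field_at p v) p" for p v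
    using linear_functional_at[OF assms]
    by (simp add: \<xi>_def bounded_linear_Blinfun_apply linear_conv_bounded_linear[symmetric])
  have eval: "\<omega> Y p = blinfun_apply (\<xi> p) (Y p)" if "Y \<in> vector_fields A" for Y p
    unfolding \<xi> using that by (intro functional_pointwise[OF assms] field_at) (simp_all add: field_at)
  show "\<forall>Y\<in>vector_fields A. pairing \<xi> Y = \<omega> Y"
    by (simp add: pairing_def eval fun_eq_iff)
  show "\<xi> \<in> one_forms A"
    unfolding one_forms_iff
  proof (intro ballI allI)
    fix c p v assume c: "c \<in> A" "p \<in> fst c"
    obtain f where f: "f \<in> smooth_functions A" "f p \<noteq> 0"
      "\<And>v. (\<lambda>q. f q *\<^sub>R tangent_of_chart A c q v) \<in> vector_fields A"
      by (rule local_frame[OF c]) (rule that)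
    have "smooth_at (\<omega> (\<lambda>q. f q *\<^sub>R tangent_of_chart A c q v)) p"
      by (rule functional_smooth[OF assms f(3)])
    also have "\<omega> (\<lambda>q. f q *\<^sub>R tangent_of_chart A c q v) =
        (\<lambda>q. f q * blinfun_apply (\<xi> q) (tangent_of_chart A c q v))"
      by (simp add: eval[OF f(3)] fun_eq_iff blinfun.scaleR_right)
    finally show "smooth_at (\<lambda>q. blinfun_apply (\<xi> q) (tangent_of_chart A c q v)) p"
      by (rule smooth_at_cancel[OF smooth_functions_iff[THEN iffD1, OF f(1), rule_format] f(2)])
  qed
qed

text \<open>Every tangent vector extends to a global field. This gives the uniqueness behind the
  definite description in \<open>flat\<close>.\<close>

lemma one_form_eqI:
  assumes "\<And>Y. Y \<in> vector_fields A \<Longrightarrow> pairing \<xi> Y = pairing \<eta> Y"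
  shows "\<xi> = \<eta>"
proof (rule ext, rule blinfun_eqI)
  fix p v
  show "blinfun_apply (\<xi> p) v = blinfun_apply (\<eta> p) v"
    using fun_cong[OF assms[OF field_at(1)[of p v]], of p] by (simp add: pairing_def field_at)
qed

end

section \<open>The musical isomorphisms of a nondegenerate form\<close>

locale nondegenerate_form = smooth_manifold A
  for A :: "('a::{t2_space, second_countable_topology}, 'e::euclidean_space) chart set" +
  fixes b :: "('a \<Rightarrow> 'e) \<Rightarrow> ('a \<Rightarrow> 'e) \<Rightarrow> 'a \<Rightarrow> real"
  assumes bilinear: "bilinear_form A (vector_fields A) b"
    and nondegenerate: "nondegenerate (vector_fields A) b"
begin

lemma functional_right: "X \<in> vector_fields A \<Longrightarrow> functional (b X)"
  using bilinear unfolding bilinear_form_def functional_def by blast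

lemma functional_left: "Y \<in> vector_fields A \<Longrightarrow> functional (\<lambda>X. b X Y)"
  using bilinear unfolding bilinear_form_def functional_def by blast

lemma form_pointwise:
  assumes "X \<in> vector_fields A" "X' \<in> vector_fields A" "Y \<in> vector_fields A" "Y' \<in> vector_fields A"
    and "X p = X' p" "Y p = Y' p"
  shows "b X Y p = b X' Y' p"
  using functional_pointwise[OF functional_right[OF assms(1)] assms(3,4,6)]
    functional_pointwise[OF functional_left[OF assms(4)] assms(1,2,5)] by simp

lemma flat_props:
  assumes "X \<in> vector_fields A"
  shows flat_one_form: "flat A b X \<in> one_forms A"
    and pairing_flat: "Y \<in> vector_fields A \<Longrightarrow> pairing (flat A b X) Y = b X Y"
proof -
  obtain \<xi> where \<xi>: "\<xi> \<in> one_forms A" "\<forall>Y\<in>vector_fields A. pairing \<xi> Y = b X Y"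
    using functional_one_form[OF functional_right[OF assms]] by blast
  have "flat A b X = \<xi>"
    unfolding flat_def
  proof (rule the_equality)
    show "\<eta> = \<xi>" if "\<eta> \<in> one_forms A \<and> (\<forall>Y\<in>vector_fields A. pairing \<eta> Y = b X Y)" for \<eta>
      using that \<xi> by (intro one_form_eqI) simp
  qed (use \<xi> in blast)
  then show "flat A b X \<in> one_forms A" "Y \<in> vector_fields A \<Longrightarrow> pairing (flat A b X) Y = b X Y"
    using \<xi> by auto
qed

lemma flat_eqI:
  assumes "X \<in> vector_fields A" "\<And>Y. Y \<in> vector_fields A \<Longrightarrow> pairing \<xi> Y = b X Y"
  shows "flat A b X = \<xi>"
  using assms by (intro one_form_eqI) (simp add: pairing_flat)

lemma flat_add:
  assumes "X \<in> vector_fields A" "Y \<in> vector_fields A"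
  shows "flat A b (\<lambda>p. X p + Y p) = (\<lambda>p. flat A b X p + flat A b Y p)"
proof (rule flat_eqI[OF vector_fields_add[OF assms]])
  fix Z assume Z: "Z \<in> vector_fields A"
  show "pairing (\<lambda>p. flat A b X p + flat A b Y p) Z = b (\<lambda>p. X p + Y p) Z"
    using functional_add[OF functional_left[OF Z] assms] pairing_flat[OF assms(1) Z] pairing_flat[OF assms(2) Z]
    by (simp add: pairing_def blinfun.add_left fun_eq_iff)
qed

lemma flat_scale:
  assumes "f \<in> smooth_functions A" "X \<in> vector_fields A"
  shows "flat A b (\<lambda>p. f p *\<^sub>R X p) = (\<lambda>p. f p *\<^sub>R flat A b X p)"
proof (rule flat_eqI[OF vector_fields_scale[OF assms]])
  fix Z assume Z: "Z \<in> vector_fields A"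
  show "pairing (\<lambda>p. f p *\<^sub>R flat A b X p) Z = b (\<lambda>p. f p *\<^sub>R X p) Z"
    using functional_scale[OF functional_left[OF Z] assms] pairing_flat[OF assms(2) Z]
    by (simp add: pairing_def blinfun.scaleR_left fun_eq_iff)
qed

lemma inj_on_flat: "inj_on (flat A b) (vector_fields A)"
proof (rule inj_onI, rule ext)
  fix X Y p assume XY: "X \<in> vector_fields A" "Y \<in> vector_fields A" "flat A b X = flat A b Y"
  have D: "(\<lambda>q. X q - Y q) \<in> vector_fields A"
    using XY by (intro vector_fields_diff)
  have "b (\<lambda>q. X q - Y q) Z p = 0" if Z: "Z \<in> vector_fields A" for Z
  proof -
    have "b (\<lambda>q. Y q + (X q - Y q)) Z p = b Y Z p + b (\<lambda>q. X q - Y q) Z p"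
      by (simp only: functional_add[OF functional_left[OF Z] XY(2) D])
    moreover have "b X Z = b Y Z"
      using pairing_flat[OF XY(1) Z] pairing_flat[OF XY(2) Z] XY(3) by simp
    ultimately show ?thesis by simp
  qed
  then have "X p - Y p = 0"
    using nondegenerate D unfolding nondegenerate_def by blast
  then show "X p = Y p" by simp
qed

section \<open>The form on the fibres and surjectivity of \<open>flat\<close>\<close>

definition form_at :: "'a \<Rightarrow> 'e \<Rightarrow> 'e \<Rightarrow> real" where
  "form_at p u v = b (field_at p u) (field_at p v) p"

lemma form_eq_form_at:
  assumes "X \<in> vector_fields A" "Y \<in> vector_fields A"
  shows "b X Y p = form_at p (X p) (Y p)"
  unfolding form_at_def using assms by (intro form_pointwise field_at) (simp_all add: field_at)

lemma linear_form_at_right: "linear (form_at p u)"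
  unfolding form_at_def by (rule linear_functional_at[OF functional_right[OF field_at(1)]])

lemma linear_form_at_left: "linear (\<lambda>u. form_at p u v)"
  unfolding form_at_def by (rule linear_functional_at[OF functional_left[OF field_at(1)]])

lemma form_at_nondegenerate:
  assumes "\<And>v. form_at p u v = 0"
  shows "u = 0"
proof -
  have "b (field_at p u) Y p = 0" if "Y \<in> vector_fields A" for Y
    using form_eq_form_at[OF field_at(1) that, of p u p] assms by (simp add: field_at)
  then show ?thesis
    using nondegenerate field_at[of p u] unfolding nondegenerate_def by metis
qed

text \<open>The Gram matrix of the form in the frame \<open>T i\<close>, as a linear map. With
  \<open>T = id\<close> it poses the problem in one fibre, with
  \<open>T = tangent_of_chart A c p\<close> in the coordinates of a chart, where the entries are
  smooth.\<close>

definition gram :: "('e \<Rightarrow> 'e) \<Rightarrow> 'a \<Rightarrow> 'e \<Rightarrow> 'e" where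
  "gram T p w = (\<Sum>i\<in>Basis. form_at p (T w) (T i) *\<^sub>R i)"

lemma linear_gram: "linear T \<Longrightarrow> linear (gram T p)"
  unfolding gram_def
  by (rule linearI)
     (simp_all add: linear_add linear_scale linear_add[OF linear_form_at_left]
       linear_scale[OF linear_form_at_left] scaleR_add_left sum.distrib scaleR_sum_right)

text \<open>If the coordinates vanish, \<open>T w\<close> pairs to zero with the frame and hence,
  \<open>T\<close> being onto, with the whole fibre.\<close>

lemma inj_gram:
  assumes "linear T" "bij T"
  shows "inj (gram T p)"
proof (subst linear_injective_0[OF linear_gram[OF assms(1)]], intro allI impI)
  fix w assume w: "gram T p w = 0"
  have Tw: "linear (\<lambda>u. form_at p (T w) (T u))"
    using linear_compose[OF assms(1) linear_form_at_right[of p "T w"]] by (simp add: comp_def)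
  have "form_at p (T w) (T i) = 0" if "i \<in> Basis" for i
  proof -
    have "form_at p (T w) (T i) = gram T p w \<bullet> i"
      using that by (simp add: gram_def)
    then show ?thesis using w by simp
  qed
  then have "form_at p (T w) (T u) = 0" for u
    by (subst linear_eq_sum_Basis[OF Tw]) simp
  then have "form_at p (T w) v = 0" for v
    using assms(2) by (metis bij_pointE)
  then have "T w = 0"
    by (rule form_at_nondegenerate)
  then show "w = 0"
    using assms linear_injective_0 bij_is_inj by blast
qed

lemma bij_tangent_of_chart:
  assumes "c \<in> A" "p \<in> fst c"
  shows "bij (tangent_of_chart A c p)"
  by (rule o_bij[where g = "tangent_to_chart A c p"])
     (use assms in \<open>auto simp: fun_eq_iff tangent_of_to_chart tangent_to_of_chart jacobian_refl\<close>)

text \<open>Both arguments are cut off by \<open>f\<close>, so \<open>f\<close> appears squared and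
  is cancelled twice.\<close>

lemma smooth_at_form_coordinates:
  assumes "c \<in> A" "p \<in> fst c"
  shows "smooth_at (\<lambda>q. form_at q (tangent_of_chart A c q v) (tangent_of_chart A c q w)) p"
proof -
  obtain f where f: "f \<in> smooth_functions A" "f p \<noteq> 0"
    "\<And>v. (\<lambda>q. f q *\<^sub>R tangent_of_chart A c q v) \<in> vector_fields A"
    by (rule local_frame[OF assms]) (rule that)
  note cancel = smooth_at_cancel[OF smooth_functions_iff[THEN iffD1, OF f(1), rule_format] f(2)]
  have "smooth_at (b (\<lambda>q. f q *\<^sub>R tangent_of_chart A c q v) (\<lambda>q. f q *\<^sub>R tangent_of_chart A c q w)) p"
    by (rule functional_smooth[OF functional_right f(3)]) (rule f(3))
  also have "b (\<lambda>q. f q *\<^sub>R tangent_of_chart A c q v) (\<lambda>q. f q *\<^sub>R tangent_of_chart A c q w)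
    = (\<lambda>q. f q * (f q * form_at q (tangent_of_chart A c q v) (tangent_of_chart A c q w)))"
    by (simp add: fun_eq_iff form_eq_form_at f(3) linear_scale[OF linear_form_at_left]
        linear_scale[OF linear_form_at_right])
  finally show ?thesis
    by (rule cancel[OF cancel])
qed

text \<open>\<open>gram id\<close> determines \<open>X\<close> at each point without regard to
  smoothness. In a chart the components of this same \<open>X\<close> solve the system with matrix
  \<open>gram (tangent_of_chart A c q) q\<close>, whose coefficients are smooth, so
  \<open>smooth_at_solution\<close> applies.\<close>

lemma flat_surj:
  assumes "\<xi> \<in> one_forms A"
  shows "\<exists>X\<in>vector_fields A. flat A b X = \<xi>"
proof -
  have "\<exists>x. gram id p x = (\<Sum>i\<in>Basis. blinfun_apply (\<xi> p) i *\<^sub>R i)" for p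
    using linear_injective_imp_surjective[OF linear_gram[OF linear_id] inj_gram[OF linear_id bij_id] refl]
    by (metis surjD)
  then obtain X where X: "\<And>p. gram id p (X p) = (\<Sum>i\<in>Basis. blinfun_apply (\<xi> p) i *\<^sub>R i)"
    by metis
  have XB: "form_at p (X p) i = blinfun_apply (\<xi> p) i" if "i \<in> Basis" for p i
  proof -
    have "form_at p (X p) i = gram id p (X p) \<bullet> i"
      using that by (simp add: gram_def)
    then show ?thesis
      using that by (simp add: X)
  qed
  have form_X: "form_at p (X p) v = blinfun_apply (\<xi> p) v" for p v
    unfolding linear_eq_sum_Basis[OF linear_form_at_right, of p "X p" v]
      linear_eq_sum_Basis[OF bounded_linear.linear[OF blinfun.bounded_linear_right], of "\<xi> p" v]
    by (intro sum.cong refl) (simp add: XB)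
  have "X \<in> vector_fields A"
    unfolding vector_fields_iff
  proof (intro ballI)
    fix c p assume c: "c \<in> A" "p \<in> fst c"
    let ?T = "tangent_of_chart A c"
    show "smooth_at (\<lambda>q. tangent_to_chart A c q (X q)) p"
    proof (rule smooth_at_solution[OF open_chart_domain[OF c(1)] c(2), where L = "\<lambda>q. gram (?T q) q"])
      fix q assume q: "q \<in> fst c"
      show "linear (gram (?T q) q)"
        by (rule linear_gram[OF linear_tangent_of_chart[OF c(1) q]])
      show "inj (gram (?T q) q)"
        by (rule inj_gram[OF linear_tangent_of_chart[OF c(1) q] bij_tangent_of_chart[OF c(1) q]])
      show "smooth_at (\<lambda>q. gram (?T q) q v) q" for v
        unfolding gram_def
        by (intro smooth_at_sum smooth_at_scaleR smooth_at_const smooth_at_form_coordinates c(1) q)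
      show "smooth_at (\<lambda>q. \<Sum>i\<in>Basis. blinfun_apply (\<xi> q) (?T q i) *\<^sub>R i) q"
        using assms c(1) q
        by (intro smooth_at_sum smooth_at_scaleR smooth_at_const) (auto simp: one_forms_iff)
      show "gram (?T q) q (tangent_to_chart A c q (X q)) = (\<Sum>i\<in>Basis. blinfun_apply (\<xi> q) (?T q i) *\<^sub>R i)"
        by (simp add: gram_def tangent_of_to_chart[OF c(1) q] form_X)
    qed
  qed
  moreover from this have "flat A b X = \<xi>"
    by (intro flat_eqI) (simp_all add: pairing_def fun_eq_iff form_eq_form_at form_X)
  ultimately show ?thesis by blast
qed

lemma sharp_props:
  assumes "\<xi> \<in> one_forms A"
  shows sharp_vector_field: "sharp A b \<xi> \<in> vector_fields A" and flat_sharp: "flat A b (sharp A b \<xi>) = \<xi>"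
proof -
  have "\<xi> \<in> flat A b ` vector_fields A"
    using flat_surj[OF assms] by blast
  then show "sharp A b \<xi> \<in> vector_fields A" "flat A b (sharp A b \<xi>) = \<xi>"
    unfolding sharp_def by (simp_all add: inv_into_into f_inv_into_f)
qed

lemma sharp_flat: "X \<in> vector_fields A \<Longrightarrow> sharp A b (flat A b X) = X"
  unfolding sharp_def by (rule inv_into_f_f[OF inj_on_flat])

lemma pairing_sharp:
  "\<xi> \<in> one_forms A \<Longrightarrow> Y \<in> vector_fields A \<Longrightarrow> b (sharp A b \<xi>) Y = pairing \<xi> Y"
  using pairing_flat[OF sharp_vector_field] flat_sharp by simp

lemma sharp_add:
  assumes "\<xi> \<in> one_forms A" "\<eta> \<in> one_forms A"
  shows "sharp A b (\<lambda>p. \<xi> p + \<eta> p) = (\<lambda>p. sharp A b \<xi> p + sharp A b \<eta> p)"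
  using flat_add[OF sharp_vector_field[OF assms(1)] sharp_vector_field[OF assms(2)]]
    sharp_flat[OF vector_fields_add[OF sharp_vector_field[OF assms(1)] sharp_vector_field[OF assms(2)]]]
    flat_sharp[OF assms(1)] flat_sharp[OF assms(2)] by simp

lemma sharp_scale:
  assumes "f \<in> smooth_functions A" "\<xi> \<in> one_forms A"
  shows "sharp A b (\<lambda>p. f p *\<^sub>R \<xi> p) = (\<lambda>p. f p *\<^sub>R sharp A b \<xi> p)"
  using flat_scale[OF assms(1) sharp_vector_field[OF assms(2)]]
    sharp_flat[OF vector_fields_scale[OF assms(1) sharp_vector_field[OF assms(2)]]]
    flat_sharp[OF assms(2)] by simp

text \<open>The value of \<open>\<xi>\<close> on any vector at \<open>p\<close> is the form applied
  to a field vanishing at \<open>p\<close>. Fibrewise nondegeneracy and definiteness of the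
  generalized metric call for this pointwise version of injectivity.\<close>

lemma sharp_zero_at:
  assumes "\<xi> \<in> one_forms A" "sharp A b \<xi> p = 0"
  shows "\<xi> p = 0"
proof (rule blinfun_eqI)
  fix v
  have "blinfun_apply (\<xi> p) v = pairing \<xi> (field_at p v) p"
    by (simp add: pairing_def field_at)
  also have "\<dots> = b (sharp A b \<xi>) (field_at p v) p"
    using assms(1) by (simp add: pairing_sharp field_at)
  also have "\<dots> = 0"
    using functional_zero_at[OF functional_left[OF field_at(1)] sharp_vector_field[OF assms(1)] assms(2)] .
  finally show "blinfun_apply (\<xi> p) v = blinfun_apply 0 v" by simp
qed

end

section \<open>The generalized tangent bundle\<close>

lemma dim_involution_image:
  fixes T :: "'v::real_vector \<Rightarrow> 'v"
  assumes "linear T" "\<And>x. T (T x) = x"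
  shows "dim (T ` S) = dim S"
proof -
  have inj: "inj T"
    using assms(2) by (metis injI)
  obtain B where B: "B \<subseteq> S" "independent B" "S \<subseteq> span B" "card B = dim S"
    using basis_exists by blast
  have "span (T ` B) = span (T ` S)"
    using B(1,3) linear_span_image[OF assms(1)]
    by (metis image_mono span_eq subset_antisym span_mono span_minimal subspace_span span_superset subset_trans)
  moreover have "independent (T ` B)"
    using linear_independent_injective_image[OF assms(1) B(2)] inj inj_on_subset by blast
  ultimately have "dim (T ` S) = card (T ` B)"
    using dim_eq_card by blast
  also have "\<dots> = card B"
    using inj by (intro card_image) (auto intro: inj_on_subset)
  finally show ?thesis using B(4) by simp
qed

section \<open>The compatible pair \<open>J\<close>, \<open>g\<close> and its fundamental
  tensor\<close>

locale almost_metric_manifold = smooth_manifold A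
  for A :: "('a::{t2_space, second_countable_topology}, 'e::euclidean_space) chart set" +
  fixes J :: "('a \<Rightarrow> 'e) \<Rightarrow> 'a \<Rightarrow> 'e"
    and g :: "('a \<Rightarrow> 'e) \<Rightarrow> ('a \<Rightarrow> 'e) \<Rightarrow> 'a \<Rightarrow> real"
    and \<alpha> \<epsilon> :: real
  assumes J_g_structure: "metric_structure A (vector_fields A) J g \<alpha> \<epsilon>"
    and \<alpha>: "\<alpha> \<in> {1, -1}" and \<epsilon>: "\<epsilon> \<in> {1, -1}"
begin

abbreviation \<phi> :: "('a \<Rightarrow> 'e) \<Rightarrow> ('a \<Rightarrow> 'e) \<Rightarrow> 'a \<Rightarrow> real" where
  "\<phi> \<equiv> fundamental_tensor J g"

lemma J_vector_field: "X \<in> vector_fields A \<Longrightarrow> J X \<in> vector_fields A"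
  using J_g_structure unfolding metric_structure_def linear_endo_def by blast

lemma J_add:
  "X \<in> vector_fields A \<Longrightarrow> Y \<in> vector_fields A \<Longrightarrow> J (\<lambda>p. X p + Y p) = (\<lambda>p. J X p + J Y p)"
  using J_g_structure unfolding metric_structure_def linear_endo_def by blast

lemma J_scale:
  "f \<in> smooth_functions A \<Longrightarrow> X \<in> vector_fields A \<Longrightarrow> J (\<lambda>p. f p *\<^sub>R X p) = (\<lambda>p. f p *\<^sub>R J X p)"
  using J_g_structure unfolding metric_structure_def linear_endo_def by blast

lemma J_J: "X \<in> vector_fields A \<Longrightarrow> J (J X) = (\<lambda>p. \<alpha> *\<^sub>R X p)"
  using J_g_structure unfolding metric_structure_def by blast

lemma g_J_J: "X \<in> vector_fields A \<Longrightarrow> Y \<in> vector_fields A \<Longrightarrow> g (J X) (J Y) = (\<lambda>p. \<epsilon> * g X Y p)"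
  using J_g_structure unfolding metric_structure_def by blast

lemma g_metric: "metric A (vector_fields A) g"
  using J_g_structure unfolding metric_structure_def by blast

lemma g_commute: "X \<in> vector_fields A \<Longrightarrow> Y \<in> vector_fields A \<Longrightarrow> g X Y = g Y X"
  using g_metric unfolding metric_def by blast

sublocale G: nondegenerate_form A g
  using g_metric unfolding metric_def by unfold_locales blast+

lemma phi_bilinear: "bilinear_form A (vector_fields A) \<phi>"
  using G.bilinear unfolding bilinear_form_def fundamental_tensor_def
  by (auto simp: J_vector_field J_add J_scale)

text \<open>The two sides are tested differently. On the left, the test field \<open>J v\<close> and
  \<open>g (J u) (J v) = \<epsilon> g u v\<close> remove \<open>J\<close>; on the right, the test
  field \<open>J u\<close> and \<open>J (J u) = \<alpha> u\<close> do.\<close>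

lemma phi_nondegenerate: "nondegenerate (vector_fields A) \<phi>"
  unfolding nondegenerate_def fundamental_tensor_def
proof (intro conjI allI ballI impI)
  fix p u assume u: "u \<in> vector_fields A" "\<forall>v\<in>vector_fields A. g (J u) v p = 0"
  have "g u v p = 0" if "v \<in> vector_fields A" for v
    using u(2)[rule_format, OF J_vector_field[OF that]] g_J_J[OF u(1) that] \<epsilon> by auto
  then show "u p = 0"
    using G.nondegenerate u(1) unfolding nondegenerate_def by blast
next
  fix p v assume v: "v \<in> vector_fields A" "\<forall>u\<in>vector_fields A. g (J u) v p = 0"
  have "g u v p = 0" if "u \<in> vector_fields A" for u
    using v(2)[rule_format, OF J_vector_field[OF that]] J_J[OF that]
      functional_const_scale[OF G.functional_left[OF v(1)] that, of \<alpha>] \<alpha> by auto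
  then show "v p = 0"
    using G.nondegenerate v(1) unfolding nondegenerate_def by blast
qed

sublocale P: nondegenerate_form A \<phi>
  by unfold_locales (rule phi_bilinear phi_nondegenerate)+

lemma flat_phi: "X \<in> vector_fields A \<Longrightarrow> flat A \<phi> X = flat A g (J X)"
  by (rule P.flat_eqI) (auto simp: G.pairing_flat J_vector_field fundamental_tensor_def)

lemma sharp_g_flat_phi: "X \<in> vector_fields A \<Longrightarrow> sharp A g (flat A \<phi> X) = J X"
  by (simp add: flat_phi G.sharp_flat J_vector_field)

lemma J_sharp_phi: "\<xi> \<in> one_forms A \<Longrightarrow> J (sharp A \<phi> \<xi>) = sharp A g \<xi>"
  using sharp_g_flat_phi[OF P.sharp_vector_field] P.flat_sharp by simp

text \<open>Since \<open>J\<close> takes \<open>sharp A \<phi> \<xi>\<close> to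
  \<open>sharp A g \<xi>\<close>, the pairing of \<open>\<xi>\<close> with \<open>J Y\<close> has a
  \<open>J\<close> in both arguments of \<open>g\<close>. Removing them costs the factor \<epsilon>,
  its own inverse.\<close>

lemma g_sharp_phi:
  assumes "\<xi> \<in> one_forms A" "Y \<in> vector_fields A"
  shows "g (sharp A \<phi> \<xi>) Y p = \<epsilon> * pairing \<xi> (J Y) p"
proof -
  have "\<epsilon> * pairing \<xi> (J Y) p = \<epsilon> * g (J (sharp A \<phi> \<xi>)) (J Y) p"
    using assms by (simp add: J_sharp_phi G.pairing_sharp J_vector_field)
  also have "\<dots> = \<epsilon> * \<epsilon> * g (sharp A \<phi> \<xi>) Y p"
    using assms by (simp add: g_J_J P.sharp_vector_field)
  finally show ?thesis using \<epsilon> by auto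
qed

lemma g_sharp_phi_sharp_phi:
  assumes "\<xi> \<in> one_forms A" "\<eta> \<in> one_forms A"
  shows "g (sharp A \<phi> \<xi>) (sharp A \<phi> \<eta>) p = \<epsilon> * g (sharp A g \<xi>) (sharp A g \<eta>) p"
  using g_sharp_phi[OF assms(1) P.sharp_vector_field[OF assms(2)]] assms
  by (simp add: J_sharp_phi G.pairing_sharp G.sharp_vector_field)

section \<open>The generalized metric\<close>

lemma gen_section_in: "X \<in> vector_fields A \<Longrightarrow> \<xi> \<in> one_forms A \<Longrightarrow> gen_section X \<xi> \<in> gen_sections A"
  by (simp add: gen_sections_def gen_section_def comp_def)

lemma gen_section_components: "fst \<circ> gen_section X \<xi> = X" "snd \<circ> gen_section X \<xi> = \<xi>"
  by (auto simp: gen_section_def)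

lemma gen_sections_components:
  "u \<in> gen_sections A \<Longrightarrow> fst \<circ> u \<in> vector_fields A" "u \<in> gen_sections A \<Longrightarrow> snd \<circ> u \<in> one_forms A"
  by (auto simp: gen_sections_def)

lemma components_add:
  "fst \<circ> (\<lambda>p. u p + v p) = (\<lambda>p. (fst \<circ> u) p + (fst \<circ> v) p)"
  "snd \<circ> (\<lambda>p. u p + v p) = (\<lambda>p. (snd \<circ> u) p + (snd \<circ> v) p)"
  by auto

lemma components_scale:
  "fst \<circ> (\<lambda>p. f p *\<^sub>R u p) = (\<lambda>p. f p *\<^sub>R (fst \<circ> u) p)"
  "snd \<circ> (\<lambda>p. f p *\<^sub>R u p) = (\<lambda>p. f p *\<^sub>R (snd \<circ> u) p)"
  by auto

lemma gen_metric_bilinear: "bilinear_form A (gen_sections A) (gen_metric A g)"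
  unfolding bilinear_form_def
proof (intro conjI ballI)
  fix u v assume u: "u \<in> gen_sections A" and v: "v \<in> gen_sections A"
  note uv = gen_sections_components[OF u] gen_sections_components[OF v]
  show "gen_metric A g u v \<in> smooth_functions A"
    unfolding gen_metric_def using uv
    by (auto simp: smooth_functions_iff intro!: smooth_at_add functional_smooth[OF G.functional_right] G.sharp_vector_field)
  {
    fix w assume w: "w \<in> gen_sections A"
    note w = gen_sections_components[OF w]
    show "gen_metric A g (\<lambda>p. u p + v p) w = (\<lambda>p. gen_metric A g u w p + gen_metric A g v w p)"
      unfolding gen_metric_def components_add G.sharp_add[OF uv(2,4)]
        functional_add[OF G.functional_left[OF w(1)] uv(1,3)]
        functional_add[OF G.functional_left[OF G.sharp_vector_field[OF w(2)]]
          G.sharp_vector_field[OF uv(2)] G.sharp_vector_field[OF uv(4)]]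
      by (simp add: algebra_simps)
    show "gen_metric A g w (\<lambda>p. u p + v p) = (\<lambda>p. gen_metric A g w u p + gen_metric A g w v p)"
      unfolding gen_metric_def components_add G.sharp_add[OF uv(2,4)]
        functional_add[OF G.functional_right[OF w(1)] uv(1,3)]
        functional_add[OF G.functional_right[OF G.sharp_vector_field[OF w(2)]]
          G.sharp_vector_field[OF uv(2)] G.sharp_vector_field[OF uv(4)]]
      by (simp add: algebra_simps)
  }
  fix f assume f: "f \<in> smooth_functions A"
  show "gen_metric A g (\<lambda>p. f p *\<^sub>R u p) v = (\<lambda>p. f p * gen_metric A g u v p)"
    unfolding gen_metric_def components_scale G.sharp_scale[OF f uv(2)]
      functional_scale[OF G.functional_left[OF uv(3)] f uv(1)]
      functional_scale[OF G.functional_left[OF G.sharp_vector_field[OF uv(4)]] f G.sharp_vector_field[OF uv(2)]]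
    by (simp add: algebra_simps)
  show "gen_metric A g u (\<lambda>p. f p *\<^sub>R v p) = (\<lambda>p. f p * gen_metric A g u v p)"
    unfolding gen_metric_def components_scale G.sharp_scale[OF f uv(4)]
      functional_scale[OF G.functional_right[OF uv(1)] f uv(3)]
      functional_scale[OF G.functional_right[OF G.sharp_vector_field[OF uv(2)]] f G.sharp_vector_field[OF uv(4)]]
    by (simp add: algebra_simps)
qed

lemma gen_metric_commute:
  assumes "u \<in> gen_sections A" "v \<in> gen_sections A"
  shows "gen_metric A g u v = gen_metric A g v u"
  unfolding gen_metric_def
  using g_commute[OF gen_sections_components(1)[OF assms(1)] gen_sections_components(1)[OF assms(2)]]
    g_commute[OF G.sharp_vector_field[OF gen_sections_components(2)[OF assms(1)]]
      G.sharp_vector_field[OF gen_sections_components(2)[OF assms(2)]]] by simp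

lemma sharp_g_zero: "sharp A g (\<lambda>p. 0) = (\<lambda>p. 0)"
  using G.sharp_scale[OF const_smooth_function[of 0] one_forms_zero] by simp

lemma gen_metric_vector_field:
  assumes "u \<in> gen_sections A" "Y \<in> vector_fields A"
  shows "gen_metric A g u (gen_section Y (\<lambda>p. 0)) = g (fst \<circ> u) Y"
  using functional_zero[OF G.functional_right[OF G.sharp_vector_field[OF gen_sections_components(2)[OF assms(1)]]]]
  by (simp add: gen_metric_def gen_section_components sharp_g_zero)

lemma gen_metric_one_form:
  assumes "u \<in> gen_sections A" "Y \<in> vector_fields A"
  shows "gen_metric A g u (gen_section (\<lambda>p. 0) (flat A g Y)) = g (sharp A g (snd \<circ> u)) Y"
  using functional_zero[OF G.functional_right[OF gen_sections_components(1)[OF assms(1)]]] assms(2)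
  by (simp add: gen_metric_def gen_section_components G.sharp_flat)

text \<open>Testing against \<open>Y + 0\<close> isolates the vector part, testing against
  \<open>0 + flat A g Y\<close> the covector part. The other side follows by symmetry.\<close>

lemma gen_metric_nondegenerate_left:
  assumes "u \<in> gen_sections A" "\<forall>v\<in>gen_sections A. gen_metric A g u v p = 0"
  shows "u p = 0"
proof -
  note u = gen_sections_components[OF assms(1)]
  have "g (fst \<circ> u) Y p = 0" "g (sharp A g (snd \<circ> u)) Y p = 0" if "Y \<in> vector_fields A" for Y
    using assms(2) gen_metric_vector_field[OF assms(1) that] gen_metric_one_form[OF assms(1) that] that
      gen_section_in[OF that one_forms_zero] gen_section_in[OF vector_fields_zero G.flat_one_form[OF that]]
    by metis+
  then have "(fst \<circ> u) p = 0" "sharp A g (snd \<circ> u) p = 0"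
    using G.nondegenerate u(1) G.sharp_vector_field[OF u(2)] unfolding nondegenerate_def by blast+
  then show ?thesis
    using G.sharp_zero_at[OF u(2)] by (simp add: prod_eq_iff)
qed

lemma gen_metric_metric: "metric A (gen_sections A) (gen_metric A g)"
  unfolding metric_def nondegenerate_def
proof (intro conjI ballI allI impI)
  show "bilinear_form A (gen_sections A) (gen_metric A g)"
    by (rule gen_metric_bilinear)
  show "gen_metric A g u v = gen_metric A g v u" if "u \<in> gen_sections A" "v \<in> gen_sections A" for u v
    using that by (rule gen_metric_commute)
  show "u p = 0" if "u \<in> gen_sections A" "\<forall>v\<in>gen_sections A. gen_metric A g u v p = 0" for p u
    using that by (rule gen_metric_nondegenerate_left)
  show "v p = 0" if "v \<in> gen_sections A" "\<forall>u\<in>gen_sections A. gen_metric A g u v p = 0" for p v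
    using that(2) by (intro gen_metric_nondegenerate_left[OF that(1)]) (simp add: gen_metric_commute[OF that(1)])
qed

text \<open>An equivalence because the pseudo-Riemannian case transfers the failure of definiteness.
  Restriction to sections \<open>X + 0\<close> recovers \<open>g\<close>; conversely the metric is a
  sum of two values of \<open>g\<close>, one of them at a nonzero vector.\<close>

lemma gen_metric_positive_definite_iff:
  "positive_definite (gen_sections A) (gen_metric A g) \<longleftrightarrow> positive_definite (vector_fields A) g"
proof
  assume pos: "positive_definite (gen_sections A) (gen_metric A g)"
  show "positive_definite (vector_fields A) g"
    unfolding positive_definite_def
  proof (intro allI ballI impI)
    fix p X assume X: "X \<in> vector_fields A" "X p \<noteq> 0"
    let ?u = "gen_section X (\<lambda>p. 0)"
    have u: "?u \<in> gen_sections A"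
      by (rule gen_section_in[OF X(1) one_forms_zero])
    moreover have "?u p \<noteq> 0"
      using X(2) by (simp add: gen_section_def prod_eq_iff)
    ultimately have "gen_metric A g ?u ?u p > 0"
      using pos unfolding positive_definite_def by blast
    then show "g X X p > 0"
      using gen_metric_vector_field[OF u X(1)] by (simp add: gen_section_components)
  qed
next
  assume pos: "positive_definite (vector_fields A) g"
  \<comment> \<open>Definiteness is silent where \<open>X\<close> vanishes; there
    \<open>functional_zero_at\<close> gives the value 0.\<close>
  have nonneg: "g X X p \<ge> 0" "X p \<noteq> 0 \<Longrightarrow> g X X p > 0" if "X \<in> vector_fields A" for X p
    using pos that functional_zero_at[OF G.functional_right[OF that] that, of p] unfolding positive_definite_def
    by (metis less_eq_real_def, blast)
  show "positive_definite (gen_sections A) (gen_metric A g)"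
    unfolding positive_definite_def
  proof (intro allI ballI impI)
    fix p u assume u: "u \<in> gen_sections A" "u p \<noteq> 0"
    note c = gen_sections_components[OF u(1)]
    note s = G.sharp_vector_field[OF c(2)]
    have "(fst \<circ> u) p \<noteq> 0 \<or> sharp A g (snd \<circ> u) p \<noteq> 0"
      using u(2) G.sharp_zero_at[OF c(2), of p] by (auto simp: prod_eq_iff)
    then show "gen_metric A g u u p > 0"
      using nonneg[OF c(1), of p] nonneg[OF s, of p] unfolding gen_metric_def by linarith
  qed
qed

lemma gen_metric_riemannian:
  "riemannian A (vector_fields A) g \<Longrightarrow> riemannian A (gen_sections A) (gen_metric A g)"
  "pseudo_riemannian A (vector_fields A) g \<Longrightarrow> pseudo_riemannian A (gen_sections A) (gen_metric A g)"
  unfolding riemannian_def pseudo_riemannian_def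
  using gen_metric_metric gen_metric_positive_definite_iff by auto

text \<open>Both structures at once: \<open>s = -1\<close> gives the complex and \<open>s = 1\<close> the product structure.\<close>

definition swap :: "real \<Rightarrow> ('a \<Rightarrow> 'e \<times> ('e \<Rightarrow>\<^sub>L real)) \<Rightarrow> 'a \<Rightarrow> 'e \<times> ('e \<Rightarrow>\<^sub>L real)" where
  "swap s u = gen_section (\<lambda>p. s *\<^sub>R sharp A \<phi> (snd \<circ> u) p) (flat A \<phi> (fst \<circ> u))"

lemma J_gen_swap: "J_gen A \<phi> = swap (-1)"
  by (simp add: fun_eq_iff J_gen_def block_def swap_def)

lemma F_gen_swap: "F_gen A \<phi> = swap 1"
  by (simp add: fun_eq_iff F_gen_def block_def swap_def)

lemma swap_components:
  "fst \<circ> swap s u = (\<lambda>p. s *\<^sub>R sharp A \<phi> (snd \<circ> u) p)" "snd \<circ> swap s u = flat A \<phi> (fst \<circ> u)"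
  by (simp_all add: swap_def gen_section_components)

lemma swap_in: "u \<in> gen_sections A \<Longrightarrow> swap s u \<in> gen_sections A"
  unfolding swap_def
  by (intro gen_section_in vector_fields_const_scale P.sharp_vector_field P.flat_one_form gen_sections_components)

lemma swap_linear: "linear_endo A (gen_sections A) (swap s)"
  unfolding linear_endo_def
proof (intro conjI ballI)
  fix u assume u: "u \<in> gen_sections A"
  note uc = gen_sections_components[OF u]
  show "swap s u \<in> gen_sections A" by (rule swap_in[OF u])
  show "swap s (\<lambda>p. u p + v p) = (\<lambda>p. swap s u p + swap s v p)" if "v \<in> gen_sections A" for v
    unfolding swap_def components_add
      P.sharp_add[OF uc(2) gen_sections_components(2)[OF that]]
      P.flat_add[OF uc(1) gen_sections_components(1)[OF that]]
    by (simp add: gen_section_def scaleR_add_right)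
  show "swap s (\<lambda>p. f p *\<^sub>R u p) = (\<lambda>p. f p *\<^sub>R swap s u p)" if "f \<in> smooth_functions A" for f
    unfolding swap_def components_scale P.sharp_scale[OF that uc(2)] P.flat_scale[OF that uc(1)]
    by (simp add: gen_section_def mult.commute)
qed

text \<open>Each component passes once through \<open>flat\<close> and once through \<open>s\<close>
  times \<open>sharp\<close>, which leaves the factor \<open>s\<close>.\<close>

lemma swap_swap:
  assumes "u \<in> gen_sections A"
  shows "swap s (swap s u) = (\<lambda>p. s *\<^sub>R u p)"
proof -
  note uc = gen_sections_components[OF assms]
  have "flat A \<phi> (\<lambda>p. s *\<^sub>R sharp A \<phi> (snd \<circ> u) p) = (\<lambda>p. s *\<^sub>R (snd \<circ> u) p)"
    using P.flat_scale[OF const_smooth_function P.sharp_vector_field[OF uc(2)], of s] P.flat_sharp[OF uc(2)] by simp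
  then show ?thesis
    unfolding swap_def[of s "swap s u"] swap_components
    by (simp add: P.sharp_flat[OF uc(1)] gen_section_def prod_eq_iff fun_eq_iff)
qed

text \<open>The vector parts contribute \<open>g (J X) (J Y)\<close> and the covector parts
  \<open>s * s = 1\<close> times the metric of their images under \<open>sharp A \<phi>\<close>.
  Each gives the factor \<epsilon>, so the sign \<open>s\<close> does not affect compatibility with
  the metric.\<close>

lemma gen_metric_swap:
  assumes "u \<in> gen_sections A" "v \<in> gen_sections A" "s \<in> {1, -1}"
  shows "gen_metric A g (swap s u) (swap s v) = (\<lambda>p. \<epsilon> * gen_metric A g u v p)"
proof
  fix p
  note uc = gen_sections_components[OF assms(1)] and vc = gen_sections_components[OF assms(2)]
  note su = P.sharp_vector_field[OF uc(2)] and sv = P.sharp_vector_field[OF vc(2)]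
  have "g (\<lambda>p. s *\<^sub>R sharp A \<phi> (snd \<circ> u) p) (\<lambda>p. s *\<^sub>R sharp A \<phi> (snd \<circ> v) p) p
    = s * s * g (sharp A \<phi> (snd \<circ> u)) (sharp A \<phi> (snd \<circ> v)) p"
    unfolding functional_const_scale[OF G.functional_left[OF vector_fields_const_scale[OF sv]] su]
      functional_const_scale[OF G.functional_right[OF su] sv] by simp
  also have "\<dots> = \<epsilon> * g (sharp A g (snd \<circ> u)) (sharp A g (snd \<circ> v)) p"
    using assms(3) g_sharp_phi_sharp_phi[OF uc(2) vc(2)] by auto
  finally show "gen_metric A g (swap s u) (swap s v) p = \<epsilon> * gen_metric A g u v p"
    unfolding gen_metric_def swap_components
    by (simp add: sharp_g_flat_phi[OF uc(1)] sharp_g_flat_phi[OF vc(1)] g_J_J[OF uc(1) vc(1)] distrib_left)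
qed

lemma swap_structure:
  "s \<in> {1, -1} \<Longrightarrow> metric_structure A (gen_sections A) (swap s) (gen_metric A g) s \<epsilon>"
  unfolding metric_structure_def
  using swap_linear swap_swap gen_metric_metric gen_metric_swap by blast

text \<open>\<open>\<xi>\<close> enters through \<open>sharp A \<phi>\<close>, which costs
  \<epsilon>, while \<open>flat A \<phi> X\<close> becomes \<open>J X\<close> under
  \<open>sharp A g\<close> and pairs with \<open>\<eta>\<close> without a sign. So only
  \<open>s * \<epsilon>\<close> matters: 1 gives \<open>2 * G0\<close>, and -1 gives
  \<open>- 2 * Omega0\<close>. This is why the two structures exchange their tensors when \<epsilon>
  changes sign.\<close>

lemma fundamental_tensor_swap:
  assumes "X \<in> vector_fields A" "Y \<in> vector_fields A" "\<xi> \<in> one_forms A" "\<eta> \<in> one_forms A"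
  shows "fundamental_tensor (swap s) (gen_metric A g) (gen_section X \<xi>) (gen_section Y \<eta>) p
    = s * \<epsilon> * pairing \<xi> (J Y) p + pairing \<eta> (J X) p"
proof -
  have "g (\<lambda>p. s *\<^sub>R sharp A \<phi> \<xi> p) Y p = s * \<epsilon> * pairing \<xi> (J Y) p"
    using functional_const_scale[OF G.functional_left[OF assms(2)] P.sharp_vector_field[OF assms(3)], of s]
      g_sharp_phi[OF assms(3,2)] by simp
  moreover have "g (J X) (sharp A g \<eta>) p = pairing \<eta> (J X) p"
    using g_commute[OF J_vector_field[OF assms(1)] G.sharp_vector_field[OF assms(4)]]
      G.pairing_sharp[OF assms(4) J_vector_field[OF assms(1)]] by simp
  ultimately show ?thesis
    unfolding fundamental_tensor_def[of "swap s"] gen_metric_def swap_components gen_section_components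
    by (simp add: sharp_g_flat_phi[OF assms(1)])
qed

lemma dim_eigenfibre_swap:
  "dim (eigenfibre (gen_sections A) (swap 1) 1 p) = dim (eigenfibre (gen_sections A) (swap 1) (-1) p)"
proof -
  define T :: "'e \<times> ('e \<Rightarrow>\<^sub>L real) \<Rightarrow> 'e \<times> ('e \<Rightarrow>\<^sub>L real)" where "T x = (fst x, - snd x)" for x
  have T: "linear T" "T (T x) = x" for x
    by (auto simp: T_def intro!: linearI)
  have sub: "T ` eigenfibre (gen_sections A) (swap 1) s p \<subseteq> eigenfibre (gen_sections A) (swap 1) (-s) p" for s
  proof
    fix y assume "y \<in> T ` eigenfibre (gen_sections A) (swap 1) s p"
    then obtain u where u: "u \<in> gen_sections A" "swap 1 u = (\<lambda>q. s *\<^sub>R u q)" "y = T (u p)"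
      unfolding eigenfibre_def by blast
    note uc = gen_sections_components[OF u(1)]
    \<comment> \<open>An eigenfibre consists of values of global eigensections, so the reflection
      \<open>T\<close> is carried out on sections. Negating the covector part changes the sign of
      the sharp component only, which turns the eigenvalue \<open>s\<close> into
      \<open>- s\<close>.\<close>
    let ?v = "gen_section (fst \<circ> u) (\<lambda>q. - (snd \<circ> u) q)"
    have v: "?v \<in> gen_sections A"
      by (intro gen_section_in uc one_forms_uminus)
    have "sharp A \<phi> (snd \<circ> u) = (\<lambda>q. s *\<^sub>R (fst \<circ> u) q)" "flat A \<phi> (fst \<circ> u) = (\<lambda>q. s *\<^sub>R (snd \<circ> u) q)"
      using swap_components[of 1 u] unfolding u(2) components_scale by simp_all
    moreover have "sharp A \<phi> (\<lambda>q. - (snd \<circ> u) q) = (\<lambda>q. - sharp A \<phi> (snd \<circ> u) q)"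
      using P.sharp_scale[OF const_smooth_function[of "-1"] uc(2)] by simp
    ultimately have "swap 1 ?v = (\<lambda>q. (- s) *\<^sub>R ?v q)"
      by (simp add: swap_def gen_section_components) (simp add: gen_section_def)
    moreover have "y = ?v p"
      by (simp add: u(3) T_def gen_section_def)
    ultimately show "y \<in> eigenfibre (gen_sections A) (swap 1) (-s) p"
      unfolding eigenfibre_def using v by blast
  qed
  \<comment> \<open>The inclusion \<open>sub\<close> at \<open>-1\<close>, read backwards through
    the involution \<open>T\<close>.\<close>
  have "eigenfibre (gen_sections A) (swap 1) (-1) p \<subseteq> T ` eigenfibre (gen_sections A) (swap 1) 1 p"
    using sub[of "-1"] T(2) by (auto simp: image_subset_iff) (metis image_iff)
  then have "T ` eigenfibre (gen_sections A) (swap 1) 1 p = eigenfibre (gen_sections A) (swap 1) (-1) p"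
    using sub[of 1] by simp
  then show ?thesis
    using dim_involution_image[OF T] by metis
qed

end

theorem proposition4p15:
  fixes A :: "('a::{t2_space, second_countable_topology}, 'e::euclidean_space) chart set"
    and J :: "('a \<Rightarrow> 'e) \<Rightarrow> 'a \<Rightarrow> 'e"
    and g \<phi> :: "('a \<Rightarrow> 'e) \<Rightarrow> ('a \<Rightarrow> 'e) \<Rightarrow> 'a \<Rightarrow> real"
    and \<alpha> \<epsilon> :: real
  assumes "metric_manifold A J g \<alpha> \<epsilon>"
  defines "\<phi> \<equiv> fundamental_tensor J g"
  shows
    "(\<epsilon> = 1 \<longrightarrow>
        (riemannian A (vector_fields A) g \<longrightarrow>
           gen_almost_hermitian A (J_gen A \<phi>) (gen_metric A g) \<and>
           gen_almost_para_norden A (F_gen A \<phi>) (gen_metric A g)) \<and>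
        (pseudo_riemannian A (vector_fields A) g \<longrightarrow>
           gen_indefinite_almost_hermitian A (J_gen A \<phi>) (gen_metric A g) \<and>
           gen_pseudo_riemannian_almost_product A (F_gen A \<phi>) (gen_metric A g)) \<and>
        (\<forall>X\<in>vector_fields A. \<forall>Y\<in>vector_fields A. \<forall>\<xi>\<in>one_forms A. \<forall>\<eta>\<in>one_forms A. \<forall>p.
           fundamental_tensor (J_gen A \<phi>) (gen_metric A g) (gen_section X \<xi>) (gen_section Y \<eta>) p =
             - 2 * Omega0 (gen_section (J X) \<xi>) (gen_section (J Y) \<eta>) p \<and>
           fundamental_tensor (F_gen A \<phi>) (gen_metric A g) (gen_section X \<xi>) (gen_section Y \<eta>) p =
             2 * G0 (gen_section (J X) \<xi>) (gen_section (J Y) \<eta>) p)) \<and>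
     (\<epsilon> = -1 \<longrightarrow>
        gen_almost_norden A (J_gen A \<phi>) (gen_metric A g) \<and>
        gen_almost_para_hermitian A (F_gen A \<phi>) (gen_metric A g) \<and>
        (\<forall>X\<in>vector_fields A. \<forall>Y\<in>vector_fields A. \<forall>\<xi>\<in>one_forms A. \<forall>\<eta>\<in>one_forms A. \<forall>p.
           fundamental_tensor (J_gen A \<phi>) (gen_metric A g) (gen_section X \<xi>) (gen_section Y \<eta>) p =
             2 * G0 (gen_section (J X) \<xi>) (gen_section (J Y) \<eta>) p \<and>
           fundamental_tensor (F_gen A \<phi>) (gen_metric A g) (gen_section X \<xi>) (gen_section Y \<eta>) p =
             - 2 * Omega0 (gen_section (J X) \<xi>) (gen_section (J Y) \<eta>) p))"


proof -
  interpret almost_metric_manifold A J g \<alpha> \<epsilon>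
    using assms(1) unfolding metric_manifold_def by unfold_locales auto
  have J_structure: "metric_structure A (gen_sections A) (J_gen A \<phi>) (gen_metric A g) (-1) \<epsilon>"
    and F_structure: "metric_structure A (gen_sections A) (F_gen A \<phi>) (gen_metric A g) 1 \<epsilon>"
    unfolding \<phi>_def J_gen_swap F_gen_swap by (rule swap_structure; simp)+
  have dim: "dim (eigenfibre (gen_sections A) (F_gen A \<phi>) 1 p) = dim (eigenfibre (gen_sections A) (F_gen A \<phi>) (-1) p)" for p
    unfolding \<phi>_def F_gen_swap by (rule dim_eigenfibre_swap)
  \<comment> \<open>\<epsilon> stays free here; inserting 1 or -1 leaves a sum or a difference of
    the two pairings, that is, \<open>G0\<close> or \<open>Omega0\<close> up to the factor 2 and a
    sign.\<close>
  have J_tensor: "fundamental_tensor (J_gen A \<phi>) (gen_metric A g) (gen_section X \<xi>) (gen_section Y \<eta>) p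
      = - \<epsilon> * pairing \<xi> (J Y) p + pairing \<eta> (J X) p"
    and F_tensor: "fundamental_tensor (F_gen A \<phi>) (gen_metric A g) (gen_section X \<xi>) (gen_section Y \<eta>) p
      = \<epsilon> * pairing \<xi> (J Y) p + pairing \<eta> (J X) p"
    if "X \<in> vector_fields A" "Y \<in> vector_fields A" "\<xi> \<in> one_forms A" "\<eta> \<in> one_forms A" for X Y \<xi> \<eta> p
    unfolding \<phi>_def J_gen_swap F_gen_swap using fundamental_tensor_swap[OF that] by simp_all
  show ?thesis
  proof (intro conjI impI)
    assume \<epsilon>: "\<epsilon> = 1"
    show "gen_almost_hermitian A (J_gen A \<phi>) (gen_metric A g)"
      "gen_almost_para_norden A (F_gen A \<phi>) (gen_metric A g)"
      if "riemannian A (vector_fields A) g"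
      using J_structure F_structure dim gen_metric_riemannian(1)[OF that]
      by (simp_all add: \<epsilon> gen_almost_hermitian_def gen_almost_para_norden_def)
    show "gen_indefinite_almost_hermitian A (J_gen A \<phi>) (gen_metric A g)"
      "gen_pseudo_riemannian_almost_product A (F_gen A \<phi>) (gen_metric A g)"
      if "pseudo_riemannian A (vector_fields A) g"
      using J_structure F_structure gen_metric_riemannian(2)[OF that]
      by (simp_all add: \<epsilon> gen_indefinite_almost_hermitian_def gen_pseudo_riemannian_almost_product_def)
  qed (use J_structure F_structure J_tensor F_tensor in
      \<open>auto simp: gen_almost_norden_def gen_almost_para_hermitian_def Omega0_def G0_def gen_section_components\<close>)
qed

end
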